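(* Let $N\ge 1$ be an integer and let $s\in(0,1)$. For every $p\in(1,2)$ there exists a non-negative function $u\in C^\infty_c(\mathbb R^N)$ such that its symmetric decreasing rearrangement satisfies $u^\star\in C^\infty_c(\mathbb R^N)$ and $$\|\nabla^s u^\star\|_{L^p(\mathbb R^N)}>\|\nabla^s u\|_{L^p(\mathbb R^N)}.$$
   Context: Fix a normalization constant $c_{N,s}>0$ (its precise value plays no role). For $u\in\mathrm{Lip}_c(\mathbb R^N)$ (Lipschitz with compact support), the Riesz fractional $s$-gradient is $$\nabla^s u(x)=c_{N,s}\int_{\mathbb R^N}\frac{(u(y)-u(x))(y-x)}{|y-x|^{N+s+1}}\,\mathrm dy,\quad x\in\mathbb R^N.$$ Symmetric decreasing rearrangement: for a non-negative measurable $u$ on $\mathbb R^N$ whose superlevel sets $\{u>\lambda\}$, $\lambda>0$, have finite measure, $u^\star(x)=\int_0^\infty\mathbf 1_{\{u>\lambda\}^\star}(x)\,\mathrm d\lambda$, where $E^\star$ is the open ball centered at the origin with $|E^\star|=|E|$. $\|\nabla^s u\|_{L^p}$ denotes the $L^p(\mathbb R^N)$ norm of $|\nabla^s u|$, with $|\cdot|$ the Euclidean norm. *)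

theory Defs
  imports "HOL-Analysis.Analysis"
begin

text \<open>
  Euclidean space of dimension \<open>N\<close> is an arbitrary type \<open>'a :: euclidean_space\<close>, with
  \<open>N = DIM('a)\<close>.
\<close>

primrec Ck :: "nat \<Rightarrow> ('a::euclidean_space \<Rightarrow> real) \<Rightarrow> bool" where
  "Ck 0 f \<longleftrightarrow> continuous_on UNIV f"
| "Ck (Suc k) f \<longleftrightarrow> (\<forall>x. f differentiable (at x)) \<and>
     (\<forall>b\<in>Basis. Ck k (\<lambda>x. frechet_derivative f (at x) b))"

definition smooth_compact_support :: "('a::euclidean_space \<Rightarrow> real) \<Rightarrow> bool" where
  "smooth_compact_support f \<longleftrightarrow> (\<forall>k. Ck k f) \<and> compact (closure {x. f x \<noteq> 0})"

text \<open>
  The integrand is \<open>0\<close> at \<open>y = x\<close>. For Lipschitz \<open>u\<close> with compact support and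
  \<open>s\<close> in \<open>(0,1)\<close> the integral converges absolutely, so the Bochner integral is the
  intended one (no principal value is involved).
\<close>

definition riesz_gradient ::
    "real \<Rightarrow> real \<Rightarrow> ('a::euclidean_space \<Rightarrow> real) \<Rightarrow> 'a \<Rightarrow> 'a" where
  "riesz_gradient c s u x =
     c *\<^sub>R (\<integral>y. ((u y - u x) / norm (y - x) powr (real DIM('a) + s + 1)) *\<^sub>R (y - x) \<partial>lebesgue)"

text \<open>
  For \<open>E\<close> of finite measure there is exactly one such ball (the empty one if \<open>E\<close> is null);
  for other \<open>E\<close> the value is unspecified.
\<close>

definition sym_ball :: "'a::euclidean_space set \<Rightarrow> 'a set" where
  "sym_ball E = (THE B. (\<exists>r. B = ball 0 r) \<and> emeasure lebesgue B = emeasure lebesgue E)"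

text \<open>
  The layer-cake integral is finite at every point when \<open>u\<close> is bounded; where it is infinite
  (possible only at the origin, for unbounded \<open>u\<close>) the value here is \<open>0\<close>.
\<close>

definition sym_decr_rearrangement :: "('a::euclidean_space \<Rightarrow> real) \<Rightarrow> 'a \<Rightarrow> real" where
  "sym_decr_rearrangement u x =
     (\<integral>l\<in>{0<..}. indicator (sym_ball {y. u y > l}) x \<partial>lebesgue)"

text \<open>The norm takes the value \<open>\<infinity>\<close> on functions whose \<open>p\<close>-th power is not integrable.\<close>

definition Lp_norm :: "real \<Rightarrow> ('a::euclidean_space \<Rightarrow> 'b::real_normed_vector) \<Rightarrow> ennreal" where
  "Lp_norm p F =
     (let I = (\<integral>\<^sup>+x. ennreal (norm (F x) powr p) \<partial>lebesgue)
      in if I = \<infinity> then \<infinity> else ennreal (enn2real I powr (1 / p)))"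

end

theory Submission
  imports Defs "HOL-Computational_Algebra.Polynomial"
begin

text \<open>
  The example is a plateau carrying a small bump. Let \<open>f\<close> be radially decreasing and constant on a
  ball around the origin, let \<open>g\<close> be a radially decreasing bump, and put
  \<open>u = f + \<epsilon> g(\<cdot> - b)\<close> with the bump sitting on the plateau, away from its centre. Every superlevel
  set of \<open>u\<close> has the same measure as the corresponding one of \<open>f + \<epsilon> g\<close>, so rearranging \<open>u\<close> only
  slides the bump to the centre: \<open>u\<^sup>\<star> = f + \<epsilon> g\<close>
  (\<open>emeasure_superlevel_translate_bump\<close>, \<open>sym_decr_rearrangement_eqI\<close>). It remains to see that a small
  bump costs more energy at the centre of the plateau than slightly off it.

  Write \<open>F\<close> and \<open>G\<close> for the fractional gradients of \<open>f\<close> and \<open>g\<close>, and \<open>W(v) = |v|\<^bsup>p-2\<^esup> v\<close>. Since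
  \<open>1 < p < 2\<close>, the energy \<open>\<integral>|F + \<epsilon> G(\<cdot> - b)|\<^sup>p\<close> equals
  \<open>\<integral>|F|\<^sup>p + p \<epsilon> \<integral>W(F) \<bullet> G(\<cdot> - b)\<close> up to an error of order \<open>\<epsilon>\<^sup>p\<close>, which for small \<open>\<epsilon>\<close> is negligible
  against \<open>\<epsilon>\<close>. Comparing the centre with the average of the two positions \<open>b = a\<close> and \<open>b = - a\<close>, and moving
  the translations from \<open>G\<close> to \<open>W(F)\<close>, one has to show that the second difference
  \<open>W(F(x + a)) + W(F(x - a)) - 2 W(F(x))\<close>, integrated against \<open>G\<close>, is negative
  (\<open>translate_lowers_energy\<close>).

  This is where \<open>p < 2\<close> enters. By symmetry \<open>F\<close> vanishes at the origin, and near it \<open>F(x)\<close> is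
  \<open>- \<kappa> x\<close> with \<open>\<kappa> > 0\<close> (\<open>frac_grad_linearization_at_0\<close>); thus \<open>W(F)\<close> behaves like
  \<open>- \<kappa>\<^bsup>p-1\<^esup> W(x)\<close>, which is not differentiable there. Dilating \<open>f\<close> enlarges the plateau and turns this
  into an exact limit (\<open>second_diff_pairing_tendsto\<close>). So the sign of the integral of
  \<open>(W(x + a) + W(x - a) - 2 W(x)) \<bullet> G(x)\<close> decides, and it can be read off pointwise: \<open>G(x)\<close> is a
  nonpositive multiple of \<open>x\<close> by reflection symmetry and monotonicity (\<open>frac_grad_radial\<close>,
  \<open>frac_grad_inward\<close>), while \<open>(W(x + a) + W(x - a)) \<bullet> x < 2 W(x) \<bullet> x\<close>
  (\<open>duality_map_midpoint\<close>), an inequality that expresses the concavity of \<open>t \<mapsto> t\<^bsup>p-1\<^esup>\<close>.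

  Two technical points recur. The fractional gradient of a radial function is collinear with \<open>x\<close> because
  Lebesgue measure is invariant under all linear isometries, which is obtained from a Vitali covering by
  balls. All integrals converge because the fractional gradient of a Lipschitz function with compact
  support is bounded and decays like \<open>|x|\<^bsup>-N-s\<^esup>\<close>.
\<close>

section \<open>Powers of the Euclidean norm\<close>

text \<open>
  This is the gradient of \<open>v \<mapsto> |v|\<^bsup>q+1\<^esup> / (q + 1)\<close>; below \<open>q = p - 1\<close> lies between \<open>0\<close> and \<open>1\<close>.
  At \<open>v = 0\<close> the value is \<open>0\<close>, as it should be, although the exponent \<open>q - 1\<close> is negative.
\<close>

definition duality_map :: "real \<Rightarrow> 'a::real_inner \<Rightarrow> 'a" where
  "duality_map q v = norm v powr (q - 1) *\<^sub>R v"

lemma norm_duality_map: "norm (duality_map q v) = norm v powr q"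
proof (cases "v = 0")
  case False
  then show ?thesis
    by (simp add: duality_map_def powr_mult_base[symmetric] powr_diff)
qed (simp add: duality_map_def)

lemma duality_map_scaleR:
  assumes "k \<ge> 0" shows "duality_map q (k *\<^sub>R v) = k powr q *\<^sub>R duality_map q v"
  using assms by (cases "k = 0") (simp_all add: duality_map_def powr_mult powr_diff)

lemma duality_map_minus: "duality_map q (- v) = - duality_map q v"
  by (simp add: duality_map_def)

lemma powr_diff_mult_le:
  fixes t r q :: real
  assumes "0 < q" "0 \<le> t" "t \<le> r" "r > 0" "q < 1"
  shows "\<bar>r powr (q - 1) - t powr (q - 1)\<bar> * t \<le> r powr (q - 1) * (r - t)"
proof (cases "t = 0")
  case False
  then have t: "t > 0" using assms by simp
  have "r powr (q - 1) \<le> t powr (q - 1)"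
    using assms t by (intro powr_mono2') auto
  moreover have "t powr (q - 1) * t = t powr q" "r powr (q - 1) * r = r powr q"
    using t assms by (simp_all add: powr_diff)
  moreover have "t powr q \<le> r powr q" using assms by (intro powr_mono2) auto
  ultimately show ?thesis by (simp add: algebra_simps)
qed (use assms in auto)

text \<open>
  Write the difference as \<open>|v|\<^bsup>q-1\<^esup> (v - w) + (|v|\<^bsup>q-1\<^esup> - |w|\<^bsup>q-1\<^esup>) w\<close> with \<open>|w| \<le> |v|\<close>. Both
  terms are at most \<open>|v|\<^bsup>q-1\<^esup> |v - w|\<close>, and \<open>|v| \<ge> |v - w| / 2\<close> while \<open>q - 1 < 0\<close>. The constant is
  not optimal.
\<close>

lemma duality_map_holder:
  fixes v w :: "'a::real_inner"
  assumes q: "0 < q" "q < 1"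
  shows "norm (duality_map q v - duality_map q w) \<le> 4 * norm (v - w) powr q"
proof -
  have *: "norm (duality_map q v - duality_map q w) \<le> 4 * norm (v - w) powr q"
    if le: "norm w \<le> norm v" for v w :: 'a
  proof (cases "v = w")
    case False
    then have r: "norm v > 0" and D: "norm (v - w) > 0" using le by auto
    have eq: "duality_map q v - duality_map q w = norm v powr (q - 1) *\<^sub>R (v - w)
        + (norm v powr (q - 1) - norm w powr (q - 1)) *\<^sub>R w"
      by (simp add: duality_map_def algebra_simps)
    have "norm (duality_map q v - duality_map q w) \<le> norm v powr (q - 1) * norm (v - w)
        + \<bar>norm v powr (q - 1) - norm w powr (q - 1)\<bar> * norm w"
      unfolding eq by (rule norm_triangle_le) simp
    also have "\<dots> \<le> norm v powr (q - 1) * norm (v - w) + norm v powr (q - 1) * (norm v - norm w)"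
      using powr_diff_mult_le[OF q(1) norm_ge_zero le r q(2)] by simp
    also have "\<dots> \<le> 2 * (norm v powr (q - 1) * norm (v - w))"
      using mult_left_mono[OF norm_triangle_ineq2[of v w], of "norm v powr (q - 1)"]
      by (simp add: mult.commute)
    also have "\<dots> \<le> 2 * ((norm (v - w) / 2) powr (q - 1) * norm (v - w))"
    proof -
      have "norm (v - w) \<le> 2 * norm v" using norm_triangle_ineq4[of v w] le by linarith
      then have "norm v powr (q - 1) \<le> (norm (v - w) / 2) powr (q - 1)"
        using q D r by (intro powr_mono2') auto
      then show ?thesis by (simp add: mult_right_mono)
    qed
    also have "\<dots> = 2 * (2 powr (1 - q) * norm (v - w) powr q)"
      using D by (simp add: powr_divide powr_diff field_simps)
    also have "\<dots> \<le> 2 * (2 powr 1 * norm (v - w) powr q)"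
      using q by (intro mult_left_mono mult_right_mono powr_mono) auto
    finally show ?thesis by simp
  qed auto
  show ?thesis
    using *[of v w] *[of w v] by (cases "norm w \<le> norm v") (auto simp: norm_minus_commute)
qed

text \<open>
  The strict form of Bernoulli's inequality, used for the equality case in the next lemma. It
  is the weighted inequality between arithmetic and geometric mean for \<open>t\<close> and \<open>1\<close>, proved through the
  logarithm.
\<close>

lemma powr_less_tangent:
  fixes t q :: real
  assumes "t > 0" "t \<noteq> 1" "0 < q" "q < 1"
  shows "t powr q < 1 + q * (t - 1)"
proof -
  define L where "L = 1 + q * (t - 1)"
  have "L = q * t + (1 - q)" by (simp add: L_def algebra_simps)
  then have L: "L > 0" using assms by (simp add: add_pos_pos)
  have "L \<noteq> 1" using assms by (simp add: L_def)
  then have 1: "ln (1 / L) < 1 / L - 1"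
    using ln_eq_minus_one[of "1 / L"] ln_le_minus_one[of "1 / L"] L by fastforce
  have 2: "ln (t / L) \<le> t / L - 1"
    using L assms by (intro ln_le_minus_one) auto
  have "q * ln (t / L) + (1 - q) * ln (1 / L) < q * (t / L - 1) + (1 - q) * (1 / L - 1)"
    using 1 2 assms by (intro add_le_less_mono mult_left_mono mult_strict_left_mono) auto
  also have "\<dots> = (q * t + (1 - q)) / L - 1"
    by (simp add: diff_divide_distrib add_divide_distrib algebra_simps)
  also have "\<dots> = 0" using L \<open>L = q * t + (1 - q)\<close> by simp
  finally have "q * ln t < ln L"
    using L assms by (simp add: ln_div algebra_simps)
  then have "exp (q * ln t) < exp (ln L)" by (subst exp_less_cancel_iff)
  then show ?thesis using L assms by (simp add: powr_def exp_ln flip: L_def)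
qed

lemma powr_midpoint:
  fixes X Y q :: real
  assumes "X > 0" "Y > 0" "0 < q" "q < 1"
  shows "X powr q + Y powr q \<le> 2 * ((X + Y) / 2) powr q"
    and "X \<noteq> Y \<Longrightarrow> X powr q + Y powr q < 2 * ((X + Y) / 2) powr q"
proof -
  define m where "m = (X + Y) / 2"
  have m: "m > 0" using assms by (simp add: m_def)
  show less: "X powr q + Y powr q < 2 * ((X + Y) / 2) powr q" if "X \<noteq> Y"
  proof -
    have "(X / m) powr q < 1 + q * (X / m - 1)" "(Y / m) powr q < 1 + q * (Y / m - 1)"
      using that m assms by (intro powr_less_tangent; simp add: m_def field_simps)+
    then have "(X / m) powr q + (Y / m) powr q < 2 + q * ((X + Y) / m - 2)"
      by (simp add: algebra_simps add_divide_distrib)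
    also have "X + Y = 2 * m" by (simp add: m_def)
    also have "2 * m / m = 2" using m by simp
    finally have "(X powr q + Y powr q) / m powr q < 2"
      using m assms by (simp add: powr_divide add_divide_distrib)
    then show ?thesis using m by (simp add: field_simps flip: m_def)
  qed
  show "X powr q + Y powr q \<le> 2 * ((X + Y) / 2) powr q"
    using less by (cases "X = Y") auto
qed

text \<open>
  The pointwise inequality that produces the sign of the whole comparison. Put \<open>X = |x + a|\<close>,
  \<open>Y = |x - a|\<close>, \<open>r = |x|\<close> and \<open>S = (X + Y) / 2\<close>, so that \<open>r \<le> S\<close>. By the polarization identities the left-hand
  side depends on \<open>X\<close>, \<open>Y\<close>, \<open>r\<close> only and has the form \<open>r\<^sup>2 m - k\<close>. In the collinear case \<open>r = S\<close> the
  claim is the concavity of \<open>t\<^sup>q\<close>; passing from \<open>S\<close> down to \<open>r\<close> loses \<open>(S\<^sup>2 - r\<^sup>2) m\<close> on the left, and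
  \<open>m \<ge> 2 S\<^bsup>q-1\<^esup>\<close> makes this enough.
\<close>

lemma duality_map_midpoint:
  fixes x a :: "'a::real_inner"
  assumes q: "0 < q" "q < 1" and "x \<noteq> 0" "a \<noteq> 0" "x + a \<noteq> 0" "x - a \<noteq> 0"
  shows "(duality_map q (x + a) + duality_map q (x - a)) \<bullet> x < 2 * (duality_map q x \<bullet> x)"
proof -
  define X Y r where "X = norm (x + a)" and "Y = norm (x - a)" and "r = norm x"
  define S where "S = (X + Y) / 2"
  define k where "k = (X\<^sup>2 - Y\<^sup>2) * (Y powr (q - 1) - X powr (q - 1)) / 4"
  define m where "m = X powr (q - 1) + Y powr (q - 1)"
  have pos: "X > 0" "Y > 0" "r > 0" "S > 0"
    using assms by (auto simp: X_def Y_def r_def S_def add_pos_pos)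
  have par: "X\<^sup>2 + Y\<^sup>2 = 2 * r\<^sup>2 + 2 * (norm a)\<^sup>2" and dif: "X\<^sup>2 - Y\<^sup>2 = 4 * (x \<bullet> a)"
    unfolding X_def Y_def r_def power2_norm_eq_inner by (simp_all add: inner_simps inner_commute)
  have rS: "r \<le> S"
  proof -
    have "2 * r = norm ((x + a) + (x - a))" by (simp add: r_def scaleR_2[symmetric])
    also have "\<dots> \<le> X + Y" unfolding X_def Y_def by (rule norm_triangle_ineq)
    finally show ?thesis by (simp add: S_def)
  qed
  have lhs: "(duality_map q (x + a) + duality_map q (x - a)) \<bullet> x = r\<^sup>2 * m - k"
  proof -
    have "(x + a) \<bullet> x = r\<^sup>2 + (X\<^sup>2 - Y\<^sup>2) / 4" "(x - a) \<bullet> x = r\<^sup>2 - (X\<^sup>2 - Y\<^sup>2) / 4"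
      unfolding dif by (simp_all add: r_def inner_simps power2_norm_eq_inner inner_commute)
    moreover have "(duality_map q (x + a) + duality_map q (x - a)) \<bullet> x
        = X powr (q - 1) * ((x + a) \<bullet> x) + Y powr (q - 1) * ((x - a) \<bullet> x)"
      by (simp only: duality_map_def X_def Y_def inner_scaleR_left
          inner_add_left[of "norm (x + a) powr (q - 1) *\<^sub>R (x + a)"])
    ultimately have "(duality_map q (x + a) + duality_map q (x - a)) \<bullet> x
        = X powr (q - 1) * (r\<^sup>2 + (X\<^sup>2 - Y\<^sup>2) / 4) + Y powr (q - 1) * (r\<^sup>2 - (X\<^sup>2 - Y\<^sup>2) / 4)"
      by (simp only:)
    also have "\<dots> = r\<^sup>2 * m - k"
      by (simp add: m_def k_def algebra_simps add_divide_distrib diff_divide_distrib)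
    finally show ?thesis .
  qed
  have rhs: "duality_map q x \<bullet> x = r powr (q + 1)"
    using pos by (simp add: duality_map_def r_def power2_norm_eq_inner[symmetric] powr_diff powr_add power2_eq_square)
  have pq: "t powr (q - 1) * t = t powr q" if "t > 0" for t :: real
    using that by (simp add: powr_diff)
  have kS: "S\<^sup>2 * m - k = S * (X powr q + Y powr q)"
    unfolding k_def m_def S_def pq[OF pos(1), symmetric] pq[OF pos(2), symmetric]
    by (simp add: field_simps power2_eq_square)
  have mS: "2 * S powr (q - 1) \<le> m"
  proof -
    define u v where "u = X powr (1 - q)" and "v = Y powr (1 - q)"
    have uv: "u > 0" "v > 0" using pos by (auto simp: u_def v_def)
    have inv: "t powr (q - 1) = 1 / t powr (1 - q)" if "t > 0" for t :: real
      using that by (simp add: powr_diff field_simps)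
    have "u + v \<le> 2 * S powr (1 - q)"
      unfolding u_def v_def S_def using powr_midpoint(1)[OF pos(1,2), of "1 - q"] q by simp
    then have "2 / S powr (1 - q) \<le> 4 / (u + v)"
      using uv pos by (simp add: field_simps)
    also have "4 / (u + v) \<le> 1 / u + 1 / v"
    proof -
      have "0 \<le> (u - v)\<^sup>2" by simp
      then show ?thesis using uv by (simp add: field_simps power2_eq_square)
    qed
    finally show ?thesis by (simp add: m_def inv pos u_def v_def)
  qed
  have S2: "S\<^sup>2 * S powr (q - 1) = S * S powr q"
    using pos by (simp add: power2_eq_square powr_diff)
  have r2: "r\<^sup>2 * r powr (q - 1) = r powr (q + 1)"
    using pos by (simp add: power2_eq_square powr_diff powr_add)
  have "r\<^sup>2 * m - k = S * (X powr q + Y powr q) - (S\<^sup>2 - r\<^sup>2) * m"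
    using kS by (simp add: algebra_simps)
  also have "\<dots> \<le> S * (X powr q + Y powr q) - (S\<^sup>2 - r\<^sup>2) * (2 * S powr (q - 1))"
    using mS rS pos by (intro diff_left_mono mult_left_mono) (auto simp: power_mono)
  also have "\<dots> < 2 * r powr (q + 1)"
  proof (cases "r = S")
    case True
    have "X \<noteq> Y"
    proof
      assume "X = Y"
      then have "X = r" using True by (simp add: S_def)
      then show False using par \<open>X = Y\<close> assms by simp
    qed
    then have "X powr q + Y powr q < 2 * S powr q"
      unfolding S_def by (intro powr_midpoint(2) pos q)
    then have "S * (X powr q + Y powr q) < S * (2 * S powr q)" using pos by simp
    then show ?thesis using True pos by (simp add: powr_add mult_ac)
  next
    case False
    have "S * (X powr q + Y powr q) \<le> S * (2 * S powr q)"
      unfolding S_def by (intro mult_left_mono powr_midpoint pos q) (use pos in auto)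
    then have "S * (X powr q + Y powr q) - (S\<^sup>2 - r\<^sup>2) * (2 * S powr (q - 1)) \<le> 2 * (r\<^sup>2 * S powr (q - 1))"
      using S2 by (simp add: algebra_simps)
    also have "\<dots> < 2 * (r\<^sup>2 * r powr (q - 1))"
      using False rS pos q by (intro mult_strict_left_mono powr_less_mono2_neg) auto
    finally show ?thesis using r2 by simp
  qed
  finally show ?thesis unfolding lhs rhs .
qed

lemma powr_Young:
  fixes r t p :: real
  assumes "p > 1" "r \<ge> 0" "t \<ge> 0"
  shows "p * (r powr (p - 1) * t) \<le> t powr p + (p - 1) * r powr p"
proof (cases "r = 0 \<or> t = 0")
  case False
  then have "(t powr p) powr (1/p) * (r powr p) powr (1 - 1/p) \<le> (1/p) * t powr p + (1 - 1/p) * r powr p"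
    using assms by (intro Youngs_inequality_0) auto
  moreover have "(t powr p) powr (1/p) = t" using False assms by (simp add: powr_powr)
  moreover have "(r powr p) powr (1 - 1/p) = r powr (p - 1)"
    using assms by (simp add: powr_powr algebra_simps)
  ultimately have "p * (t * r powr (p - 1)) \<le> p * ((1/p) * t powr p + (1 - 1/p) * r powr p)"
    using assms by (intro mult_left_mono) auto
  then show ?thesis using assms by (simp add: algebra_simps)
qed (use assms in auto)

text \<open>
  Convexity of \<open>|v|\<^sup>p\<close>, in the form of its tangent inequality: Cauchy-Schwarz reduces it to Young's
  inequality for \<open>|v|\<close> and \<open>|v + w|\<close>.
\<close>

lemma norm_powr_add_ge:
  fixes v w :: "'a::real_inner"
  assumes p: "p > 1"
  shows "norm v powr p + p * (duality_map (p - 1) v \<bullet> w) \<le> norm (v + w) powr p"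
proof -
  have sq: "norm v powr (p - 2) * (v \<bullet> v) = norm v powr p"
    by (cases "v = 0") (simp_all add: power2_norm_eq_inner[symmetric] powr_diff)
  have "duality_map (p - 1) v \<bullet> (v + w) \<le> norm v powr (p - 1) * norm (v + w)"
    using norm_cauchy_schwarz[of "duality_map (p - 1) v" "v + w"] by (simp add: norm_duality_map)
  moreover have "duality_map (p - 1) v \<bullet> (v + w) = norm v powr p + duality_map (p - 1) v \<bullet> w"
    using sq by (simp add: duality_map_def inner_simps algebra_simps)
  ultimately have "p * (norm v powr p + duality_map (p - 1) v \<bullet> w) \<le> p * (norm v powr (p - 1) * norm (v + w))"
    using p by simp
  also have "\<dots> \<le> norm (v + w) powr p + (p - 1) * norm v powr p"
    using p by (intro powr_Young) auto
  finally show ?thesis by (simp add: algebra_simps)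
qed

text \<open>
  The tangent inequality at \<open>v + w\<close> gives an upper bound with the gradient taken at \<open>v + w\<close>; Hoelder
  continuity of the gradient then moves it back to \<open>v\<close> at a cost of order \<open>|w|\<^sup>p\<close>.
\<close>

lemma norm_powr_add_le:
  fixes v w :: "'a::real_inner"
  assumes p: "1 < p" "p < 2"
  shows "norm (v + w) powr p \<le> norm v powr p + p * (duality_map (p - 1) v \<bullet> w) + 4 * p * norm w powr p"
proof -
  let ?d = "duality_map (p - 1) (v + w) - duality_map (p - 1) v"
  have "norm (v + w) powr p - p * (duality_map (p - 1) (v + w) \<bullet> w) \<le> norm v powr p"
    using norm_powr_add_ge[OF p(1), of "v + w" "- w"] by simp
  moreover have "?d \<bullet> w \<le> 4 * norm w powr p"
  proof -
    have "?d \<bullet> w \<le> norm ?d * norm w" by (rule norm_cauchy_schwarz)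
    also have "\<dots> \<le> (4 * norm w powr (p - 1)) * norm w"
      using duality_map_holder[of "p - 1" "v + w" v] p by (intro mult_right_mono) auto
    also have "\<dots> = 4 * norm w powr p" by (cases "w = 0") (simp_all add: powr_diff)
    finally show ?thesis .
  qed
  then have "p * (?d \<bullet> w) \<le> p * (4 * norm w powr p)" using p by simp
  ultimately show ?thesis by (simp add: inner_diff_left algebra_simps)
qed

section \<open>Lebesgue measure: isometries and integrable powers\<close>

lemma distr_lborel_translate: "distr lborel borel (\<lambda>x. x + a) = (lborel :: 'a::euclidean_space measure)"
  using lborel_distr_plus[of a] by (simp add: add.commute[of _ a])

lemma lborel_integral_translate:
  fixes f :: "'a::euclidean_space \<Rightarrow> 'b::{banach, second_countable_topology}"
  assumes [measurable]: "f \<in> borel_measurable borel"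
  shows "(\<integral>x. f (x + a) \<partial>lborel) = (\<integral>x. f x \<partial>lborel)"
  using integral_distr[of "\<lambda>x. x + a" lborel borel f] by (simp add: distr_lborel_translate)

lemma lborel_integrable_translate:
  fixes f :: "'a::euclidean_space \<Rightarrow> 'b::{banach, second_countable_topology}"
  assumes "integrable lborel f"
  shows "integrable lborel (\<lambda>x. f (x + a))"
proof -
  have [measurable]: "f \<in> borel_measurable borel" using borel_measurable_integrable[OF assms] by simp
  show ?thesis
    using assms integrable_distr_eq[of "\<lambda>x. x + a" lborel borel f] by (simp add: distr_lborel_translate)
qed

lemma lborel_integral_scale:
  fixes f :: "'a::euclidean_space \<Rightarrow> 'b::{banach, second_countable_topology}"
  assumes c: "c > 0" and [measurable]: "f \<in> borel_measurable borel"
  shows "(\<integral>x. f x \<partial>lborel) = c ^ DIM('a) *\<^sub>R (\<integral>x. f (c *\<^sub>R x) \<partial>lborel)"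
proof -
  have "(\<integral>x. f x \<partial>lborel)
      = (\<integral>x. f x \<partial>density (distr lborel borel (\<lambda>x. 0 + c *\<^sub>R x)) (\<lambda>_. ennreal (\<bar>c\<bar> ^ DIM('a))))"
    using c by (subst lborel_affine[of c 0]) (simp_all add: ennreal_power)
  also have "\<dots> = (\<integral>x. (\<bar>c\<bar> ^ DIM('a)) *\<^sub>R f (c *\<^sub>R x) \<partial>lborel)"
    by (subst integral_density) (auto simp: integral_distr)
  finally show ?thesis using c by simp
qed

lemma emeasure_lborel_ball_cong:
  "emeasure lborel (ball (a::'a::euclidean_space) r) = emeasure lborel (ball (b::'a) r)"
  by (cases "r \<ge> 0") (simp_all add: emeasure_ball ball_empty)

text \<open>
  An isometry maps balls to balls of the same radius, so it preserves their measure. By Vitali's theorem an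
  open set is, up to a null set, a countable disjoint union of balls. Nothing is known yet about the preimage of
  the null set, which is why only an inequality comes out; applying it to the inverse isometry as well gives
  equality.
\<close>

lemma emeasure_orthogonal_vimage_ge:
  fixes T :: "'a::euclidean_space \<Rightarrow> 'a"
  assumes T: "orthogonal_transformation T" and S: "open S"
  shows "emeasure lborel S \<le> emeasure lborel (T -` S)"
proof -
  have cont: "continuous_on UNIV T"
    using T by (simp add: linear_continuous_on linear_linear orthogonal_transformation_linear)
  have [measurable]: "T \<in> borel_measurable borel" by (rule borel_measurable_continuous_onI[OF cont])
  have oT: "open (T -` S)" by (rule open_vimage[OF S cont])
  define K where "K = {(c, r). r > 0 \<and> ball c r \<subseteq> S}"
  have "\<exists>i. i \<in> K \<and> x \<in> ball (fst i) (snd i) \<and> snd i < d" if "x \<in> S" "0 < d" for x d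
  proof -
    obtain e where e: "e > 0" "ball x e \<subseteq> S" using S \<open>x \<in> S\<close> openE by blast
    have "(x, min e (d / 2)) \<in> K" using e that by (auto simp: K_def)
    then show ?thesis using e that by (intro exI[of _ "(x, min e (d / 2))"]) auto
  qed
  from Vitali_covering_theorem_balls[of S K fst snd, OF this]
  obtain C where C: "countable C" "C \<subseteq> K"
      "pairwise (\<lambda>i j. disjnt (ball (fst i) (snd i)) (ball (fst j) (snd j))) C"
      "negligible (S - (\<Union>i\<in>C. ball (fst i) (snd i)))" by blast
  let ?B = "\<lambda>i. ball (fst i) (snd i) :: 'a set"
  have disj: "disjoint_family_on ?B C"
    using C(3) by (auto simp: disjoint_family_on_def pairwise_def disjnt_def)
  have vB: "T -` ball (T c) r = ball c r" for c r
    using T by (auto simp: dist_norm orthogonal_transformation_norm orthogonal_transformation_linear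
        simp flip: linear_diff[OF orthogonal_transformation_linear[OF T]])
  have vB': "emeasure lborel (T -` ball c r) = emeasure lborel (ball c r)" for c r
  proof -
    obtain c' where "c = T c'" using orthogonal_transformation_surj[OF T] by (metis surjD)
    then show ?thesis using vB emeasure_lborel_ball_cong by metis
  qed
  have U: "(\<Union>i\<in>C. ?B i) \<in> sets lborel" by (auto intro!: borel_open)
  then have "emeasure lborel S \<le> emeasure lborel ((\<Union>i\<in>C. ?B i) \<union> (S - (\<Union>i\<in>C. ?B i)))"
    using S by (intro emeasure_mono sets.Un sets.Diff) auto
  also have "\<dots> = emeasure lborel (\<Union>i\<in>C. ?B i)"
  proof (rule emeasure_Un_null_set)
    show "(\<Union>i\<in>C. ?B i) \<in> sets lborel" by (rule U)
    show "S - (\<Union>i\<in>C. ?B i) \<in> null_sets lborel"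
      using C(4) S U by (simp add: negligible_iff_null_sets null_sets_completion_iff)
  qed
  also have "\<dots> = (\<integral>\<^sup>+i. emeasure lborel (?B i) \<partial>count_space C)"
    using C(1) disj by (intro emeasure_UN_countable) auto
  also have "\<dots> = (\<integral>\<^sup>+i. emeasure lborel (T -` ?B i) \<partial>count_space C)"
    by (simp add: vB')
  also have "\<dots> = emeasure lborel (\<Union>i\<in>C. T -` ?B i)"
  proof (rule emeasure_UN_countable[symmetric])
    show "T -` ?B i \<in> sets lborel" for i using open_vimage[OF open_ball cont] by simp
    show "disjoint_family_on (\<lambda>i. T -` ?B i) C" using disj unfolding disjoint_family_on_def by blast
  qed (rule C(1))
  also have "\<dots> \<le> emeasure lborel (T -` S)"
  proof (rule emeasure_mono)
    show "(\<Union>i\<in>C. T -` ?B i) \<subseteq> T -` S" using C(2) by (fastforce simp: K_def)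
  qed (use oT in simp)
  finally show ?thesis .
qed

lemma distr_lborel_orthogonal:
  fixes T :: "'a::euclidean_space \<Rightarrow> 'a"
  assumes T: "orthogonal_transformation T"
  shows "distr lborel borel T = lborel"
proof (rule lborel_eqI[symmetric])
  fix l u :: 'a assume le: "\<And>b. b \<in> Basis \<Longrightarrow> l \<bullet> b \<le> u \<bullet> b"
  have cont: "continuous_on UNIV T"
    using T by (simp add: linear_continuous_on linear_linear orthogonal_transformation_linear)
  have [measurable]: "T \<in> borel_measurable borel" by (rule borel_measurable_continuous_onI[OF cont])
  have oT: "open (T -` box l u)" by (rule open_vimage[OF open_box cont])
  have "inv T -` (T -` box l u) = box l u"
    using orthogonal_transformation_surj[OF T] by (auto simp: surj_f_inv_f)
  then have "emeasure lborel (T -` box l u) = emeasure lborel (box l u)"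
    using emeasure_orthogonal_vimage_ge[OF T open_box, of l u]
      emeasure_orthogonal_vimage_ge[OF orthogonal_transformation_inv[OF T] oT] by simp
  then show "emeasure (distr lborel borel T) (box l u) = (\<Prod>b\<in>Basis. (u - l) \<bullet> b)"
    using le by (simp add: emeasure_distr)
qed simp

lemma lborel_integral_orthogonal:
  fixes f :: "'a::euclidean_space \<Rightarrow> 'b::{banach, second_countable_topology}" and T :: "'a \<Rightarrow> 'a"
  assumes T: "orthogonal_transformation T" and [measurable]: "f \<in> borel_measurable borel"
  shows "(\<integral>x. f (T x) \<partial>lborel) = (\<integral>x. f x \<partial>lborel)"
proof -
  have [measurable]: "T \<in> borel_measurable borel"
    using T by (intro borel_measurable_continuous_onI)
      (simp add: linear_continuous_on linear_linear orthogonal_transformation_linear)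
  show ?thesis
    using integral_distr[of T lborel borel f] by (simp add: distr_lborel_orthogonal[OF T])
qed

lemma lborel_integrable_orthogonal:
  fixes f :: "'a::euclidean_space \<Rightarrow> 'b::{banach, second_countable_topology}" and T :: "'a \<Rightarrow> 'a"
  assumes T: "orthogonal_transformation T" and f: "integrable lborel f"
  shows "integrable lborel (\<lambda>x. f (T x))"
proof -
  have [measurable]: "T \<in> borel_measurable borel"
    using T by (intro borel_measurable_continuous_onI)
      (simp add: linear_continuous_on linear_linear orthogonal_transformation_linear)
  have [measurable]: "f \<in> borel_measurable borel" using borel_measurable_integrable[OF f] by simp
  show ?thesis
    using f integrable_distr_eq[of T lborel borel f] by (simp add: distr_lborel_orthogonal[OF T])
qed

lemma not_AE_notin_open:
  fixes S :: "'a::euclidean_space set"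
  assumes "open S" "x \<in> S"
  shows "\<not> (AE z in lborel. z \<notin> S)"
proof
  assume "AE z in lborel. z \<notin> S"
  then have "S \<in> null_sets lborel" using assms by (subst AE_iff_null_sets) auto
  then have "negligible S" by (simp add: negligible_iff_null_sets null_sets_completionI)
  then show False using open_not_negligible assms by blast
qed

text \<open>
  A substitute for polar coordinates: a function dominated by the sum of \<open>c\<^sub>k\<close> times the indicator of a ball of
  radius \<open>r\<^sub>k\<close> has integral at most a multiple of \<open>\<Sum> c\<^sub>k r\<^sub>k\<^sup>N\<close>. Dyadic radii turn power functions into
  geometric series.
\<close>

lemma integrable_dominated_by_balls:
  fixes f :: "'a::euclidean_space \<Rightarrow> real" and c r :: "nat \<Rightarrow> real"
  assumes [measurable]: "f \<in> borel_measurable borel"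
    and c: "\<And>k. c k \<ge> 0" and r: "\<And>k. r k \<ge> 0"
    and sm: "summable (\<lambda>k. c k * r k ^ DIM('a))"
    and dom: "\<And>x. x \<noteq> 0 \<Longrightarrow> f x \<noteq> 0 \<Longrightarrow> \<exists>k. \<bar>f x\<bar> \<le> c k \<and> norm x < r k"
  shows "integrable lborel f"
proof (rule integrableI_bounded)
  define V where "V = unit_ball_vol (DIM('a))"
  have V: "V \<ge> 0" by (simp add: V_def)
  have "(\<integral>\<^sup>+x. ennreal (norm (f x)) \<partial>lborel)
      \<le> (\<integral>\<^sup>+(x::'a). (\<Sum>k. ennreal (c k) * indicator (ball 0 (r k)) x) \<partial>lborel)"
  proof (rule nn_integral_mono_AE)
    have "AE x in lborel. x \<noteq> (0::'a)" by (rule AE_lborel_singleton)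
    then show "AE x in lborel. ennreal (norm (f x)) \<le> (\<Sum>k. ennreal (c k) * indicator (ball 0 (r k)) x)"
    proof eventually_elim
      case (elim x)
      show ?case
      proof (cases "f x = 0")
        case False
        then obtain k where k: "\<bar>f x\<bar> \<le> c k" "norm x < r k" using dom elim by blast
        then have "ennreal (norm (f x)) \<le> ennreal (c k) * indicator (ball 0 (r k)) x"
          by (auto simp: indicator_def)
        also have "F k \<le> suminf F" for F :: "nat \<Rightarrow> ennreal"
          using sum_le_suminf[OF summableI, of "{k}" F] by simp
        finally show ?thesis .
      qed auto
    qed
  qed
  also have "\<dots> = (\<Sum>k. \<integral>\<^sup>+x. ennreal (c k) * indicator (ball 0 (r k)) x \<partial>(lborel :: 'a measure))"
    by (rule nn_integral_suminf) (auto intro!: borel_measurable_times_ennreal borel_measurable_indicator)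
  also have "\<dots> = (\<Sum>k. ennreal (V * (c k * r k ^ DIM('a))))"
  proof (rule arg_cong[where f=suminf], rule ext)
    fix k
    have "(\<integral>\<^sup>+x. ennreal (c k) * indicator (ball 0 (r k)) x \<partial>(lborel :: 'a measure))
        = ennreal (c k) * emeasure lborel (ball (0::'a) (r k))"
      by (subst nn_integral_cmult_indicator) auto
    also have "\<dots> = ennreal (V * (c k * r k ^ DIM('a)))"
      using c[of k] r[of k] V
      by (simp add: emeasure_ball ennreal_mult[symmetric] V_def[symmetric] mult_ac)
    finally show "(\<integral>\<^sup>+x. ennreal (c k) * indicator (ball 0 (r k)) x \<partial>(lborel :: 'a measure))
        = ennreal (V * (c k * r k ^ DIM('a)))" .
  qed
  also have "\<dots> = ennreal (\<Sum>k. V * (c k * r k ^ DIM('a)))"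
    using c r V sm by (intro suminf_ennreal2) (auto intro!: summable_mult)
  also have "\<dots> < \<infinity>" by simp
  finally show "(\<integral>\<^sup>+x. ennreal (norm (f x)) \<partial>lborel) < \<infinity>" .
qed simp

lemma dyadic_bracket:
  fixes t :: real assumes "t \<ge> 1"
  shows "\<exists>k::nat. 2 ^ k \<le> t \<and> t < 2 ^ (k + 1)"
proof -
  have l: "log 2 t \<ge> 0" using assms by simp
  define k where "k = nat \<lfloor>log 2 t\<rfloor>"
  have k: "real k \<le> log 2 t" "log 2 t < real (k + 1)" using l by (auto simp: k_def) linarith+
  have "2 powr real k \<le> t" using k assms by (subst (asm) le_log_iff) auto
  moreover have "t < 2 powr real (k + 1)" using k assms by (subst (asm) log_less_iff) auto
  ultimately have "2 ^ k \<le> t \<and> t < 2 ^ (k + 1)" by (simp only: powr_realpow zero_less_numeral)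
  then show ?thesis by blast
qed

lemma integrable_powr_at_infinity:
  assumes "\<delta> > 0"
  shows "integrable lborel (\<lambda>x::'a::euclidean_space. (1 + norm x) powr (- real DIM('a) - \<delta>))"
proof (rule integrable_dominated_by_balls[where c="\<lambda>k. (2 ^ k) powr (- real DIM('a) - \<delta>)" and r="\<lambda>k. 2 ^ (k + 1)"])
  have "(2 ^ k) powr (- real DIM('a) - \<delta>) * (2 ^ (k + 1)) ^ DIM('a) = 2 powr DIM('a) * (2 powr (- \<delta>)) ^ k" for k :: nat
    by (simp add: powr_realpow[symmetric] powr_powr powr_add[symmetric] algebra_simps)
  moreover have "summable (\<lambda>k. 2 powr DIM('a) * (2 powr (- \<delta>)) ^ k)"
    using assms by (intro summable_mult summable_geometric) (simp add: powr_minus powr_less_one field_simps)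
  ultimately show "summable (\<lambda>k. (2 ^ k) powr (- real DIM('a) - \<delta>) * (2 ^ (k + 1)) ^ DIM('a))" by (simp only:)
  fix x :: 'a
  obtain k :: nat where k: "2 ^ k \<le> 1 + norm x" "1 + norm x < 2 ^ (k + 1)"
    using dyadic_bracket[of "1 + norm x"] by auto
  then have "(1 + norm x) powr (- real DIM('a) - \<delta>) \<le> (2 ^ k) powr (- real DIM('a) - \<delta>)"
    using assms by (intro powr_mono2') auto
  then show "\<exists>k. \<bar>(1 + norm x) powr (- real DIM('a) - \<delta>)\<bar> \<le> (2 ^ k) powr (- real DIM('a) - \<delta>)
      \<and> norm x < 2 ^ (k + 1)"
    using k by (intro exI[of _ k]) auto
qed auto

lemma integrable_powr_at_origin:
  assumes "\<delta> > 0" "\<delta> \<le> real DIM('a)"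
  shows "integrable lborel (\<lambda>x::'a::euclidean_space. indicator (ball 0 1) x * norm x powr (\<delta> - real DIM('a)))"
proof (rule integrable_dominated_by_balls[where c="\<lambda>k. (1 / 2 ^ (k + 1)) powr (\<delta> - real DIM('a))" and r="\<lambda>k. 1 / 2 ^ k"])
  have "(1 / 2 ^ (k + 1)) powr (\<delta> - real DIM('a)) * (1 / 2 ^ k) ^ DIM('a)
      = 2 powr (real DIM('a) - \<delta>) * (2 powr (- \<delta>)) ^ k" for k :: nat
  proof -
    have "1 / 2 ^ (k + 1) = (2::real) powr (- real k - 1)" "(1 / 2 ^ k) = (2::real) powr (- real k)"
      by (simp_all add: powr_diff powr_minus powr_realpow field_simps)
    then show ?thesis
      by (simp only:) (simp add: powr_realpow[symmetric] powr_powr powr_add[symmetric] algebra_simps)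
  qed
  moreover have "summable (\<lambda>k. 2 powr (real DIM('a) - \<delta>) * (2 powr (- \<delta>)) ^ k)"
    using assms by (intro summable_mult summable_geometric) (simp add: powr_minus powr_less_one field_simps)
  ultimately show "summable (\<lambda>k. (1 / 2 ^ (k + 1)) powr (\<delta> - real DIM('a)) * (1 / 2 ^ k) ^ DIM('a))" by (simp only:)
  fix x :: 'a
  assume x: "x \<noteq> 0" "indicator (ball 0 1) x * norm x powr (\<delta> - real DIM('a)) \<noteq> 0"
  then have x1: "norm x < 1" "norm x > 0" by (auto simp: indicator_def split: if_splits)
  obtain k :: nat where k: "2 ^ k \<le> 1 / norm x" "1 / norm x < 2 ^ (k + 1)"
    using dyadic_bracket[of "1 / norm x"] x1 by auto
  show "\<exists>k. \<bar>indicator (ball 0 1) x * norm x powr (\<delta> - real DIM('a))\<bar>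
       \<le> (1 / 2 ^ (k + 1)) powr (\<delta> - real DIM('a)) \<and> norm x < 1 / 2 ^ k"
  proof (cases "norm x < 1 / 2 ^ k")
    case True
    have "1 / 2 ^ (k + 1) \<le> norm x" using k x1 by (simp add: field_simps)
    then have "norm x powr (\<delta> - real DIM('a)) \<le> (1 / 2 ^ (k + 1)) powr (\<delta> - real DIM('a))"
      using assms by (intro powr_mono2') auto
    then show ?thesis using True x1 by (intro exI[of _ k]) (auto simp: indicator_def)
  next
    case False
    then have eq: "norm x = 1 / 2 ^ k" using k x1 by (simp add: field_simps)
    then obtain j where j: "k = Suc j" using x1 by (cases k) auto
    have "(1::real) / 2 ^ k < 1 / 2 ^ j" by (simp add: j field_simps)
    then show ?thesis using eq x1 by (intro exI[of _ j]) (auto simp: indicator_def j)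
  qed
qed (auto intro!: borel_measurable_times borel_measurable_indicator)

section \<open>Smooth functions and a smooth cut-off\<close>

lemma frechet_derivative_eqI: "(f has_derivative f') (at x) \<Longrightarrow> frechet_derivative f (at x) = f'"
  by (rule frechet_derivative_at[symmetric])

lemma Ck_SucI:
  assumes "\<And>x. (f has_derivative f' x) (at x)" "\<And>b. b \<in> Basis \<Longrightarrow> Ck k (\<lambda>x. f' x b)"
  shows "Ck (Suc k) f"
  using assms by (auto simp: differentiable_def frechet_derivative_eqI[OF assms(1)])

lemma Ck_has_derivative:
  "Ck (Suc k) f \<Longrightarrow> (f has_derivative frechet_derivative f (at x)) (at x)"
  by (simp flip: frechet_derivative_works)

lemma Ck_SucD: "Ck (Suc k) f \<Longrightarrow> Ck k f"
proof (induction k arbitrary: f)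
  case 0
  then show ?case by (auto intro!: differentiable_imp_continuous_on simp: differentiable_on_def)
next
  case (Suc k)
  show ?case unfolding Ck.simps(2)[of k f]
  proof (intro conjI ballI)
    show "\<forall>x. f differentiable at x" using Suc.prems by simp
    show "Ck k (\<lambda>x. frechet_derivative f (at x) b)" if "b \<in> Basis" for b
      using Suc.prems that by (intro Suc.IH) (simp only: Ck.simps(2)[of "Suc k"])
  qed
qed

lemma Ck_const: "Ck k (\<lambda>x. c)"
proof (induction k arbitrary: c)
  case (Suc k)
  show ?case by (rule Ck_SucI[where f'="\<lambda>x h. 0"]) (rule has_derivative_const, rule Suc)
qed simp

lemma Ck_add: "Ck k f \<Longrightarrow> Ck k g \<Longrightarrow> Ck k (\<lambda>x. f x + g x)"
proof (induction k arbitrary: f g)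
  case (Suc k)
  show ?case
  proof (rule Ck_SucI)
    show "((\<lambda>x. f x + g x) has_derivative
        (\<lambda>h. frechet_derivative f (at x) h + frechet_derivative g (at x) h)) (at x)" for x
      by (intro has_derivative_add Ck_has_derivative[OF Suc.prems(1)] Ck_has_derivative[OF Suc.prems(2)])
    show "Ck k (\<lambda>x. frechet_derivative f (at x) b + frechet_derivative g (at x) b)" if "b \<in> Basis" for b
      using Suc.prems that by (intro Suc.IH) auto
  qed
qed (simp add: continuous_on_add)

lemma Ck_mult: "Ck k f \<Longrightarrow> Ck k g \<Longrightarrow> Ck k (\<lambda>x. f x * g x)"
proof (induction k arbitrary: f g)
  case (Suc k)
  have "Ck k (\<lambda>x. f x * frechet_derivative g (at x) b + frechet_derivative f (at x) b * g x)"
    if "b \<in> Basis" for b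
    using Suc.prems that
    by (intro Ck_add Suc.IH Ck_SucD[OF Suc.prems(1)] Ck_SucD[OF Suc.prems(2)]) auto
  moreover have "((\<lambda>x. f x * g x) has_derivative
      (\<lambda>h. f x * frechet_derivative g (at x) h + frechet_derivative f (at x) h * g x)) (at x)" for x
    by (intro has_derivative_mult Ck_has_derivative[OF Suc.prems(1)] Ck_has_derivative[OF Suc.prems(2)])
  ultimately show ?case by (rule Ck_SucI[rotated])
qed (simp add: continuous_on_mult)

lemma Ck_inner_const: "Ck k (\<lambda>x. x \<bullet> b)"
proof (cases k)
  case (Suc j)
  show ?thesis unfolding Suc
    by (rule Ck_SucI[where f'="\<lambda>x h. h \<bullet> b"]) (auto intro!: derivative_eq_intros Ck_const)
qed (auto intro!: continuous_intros)

lemma Ck_norm_square: "Ck k (\<lambda>x. (norm x)\<^sup>2)"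
proof (cases k)
  case (Suc j)
  show ?thesis unfolding Suc power2_norm_eq_inner
  proof (rule Ck_SucI)
    show "((\<lambda>x. x \<bullet> x) has_derivative (\<lambda>h. 2 * (x \<bullet> h))) (at x)" for x :: 'a
      by (rule derivative_eq_intros | simp add: inner_commute)+
  qed (intro Ck_mult Ck_const Ck_inner_const)
qed (auto intro!: continuous_intros)

lemma Ck_affine:
  fixes f :: "'a::euclidean_space \<Rightarrow> real"
  shows "Ck k f \<Longrightarrow> Ck k (\<lambda>x. f (c *\<^sub>R x + a))"
proof (induction k arbitrary: f)
  case 0
  have "continuous_on UNIV (\<lambda>x. c *\<^sub>R x + a)" by (intro continuous_intros)
  with 0 show ?case using continuous_on_compose2[of UNIV f UNIV "\<lambda>x. c *\<^sub>R x + a"] by simp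
next
  case (Suc k)
  show ?case
  proof (rule Ck_SucI)
    fix x
    have "((\<lambda>x. c *\<^sub>R x + a) has_derivative (\<lambda>h. c *\<^sub>R h)) (at x)"
      by (auto intro!: derivative_eq_intros)
    from has_derivative_compose[OF this Ck_has_derivative[OF Suc.prems]]
    show "((\<lambda>x. f (c *\<^sub>R x + a)) has_derivative (\<lambda>h. frechet_derivative f (at (c *\<^sub>R x + a)) (c *\<^sub>R h))) (at x)" .
  next
    fix b :: 'a assume b: "b \<in> Basis"
    have "frechet_derivative f (at y) (c *\<^sub>R b) = c * frechet_derivative f (at y) b" for y
      using linear_frechet_derivative[of f "at y"] Suc.prems by (simp add: linear_scale)
    then show "Ck k (\<lambda>x. frechet_derivative f (at (c *\<^sub>R x + a)) (c *\<^sub>R b))"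
      using Suc.prems b by (auto intro!: Ck_mult Ck_const Suc.IH)
  qed
qed

text \<open>
  The outer function is given with all its derivatives, \<open>\<phi> j\<close> being the \<open>j\<close>-th one. The induction needs the
  statement for every \<open>j\<close>, since the chain rule leads from \<open>\<phi> j\<close> to \<open>\<phi> (Suc j)\<close>.
\<close>

lemma Ck_compose:
  fixes \<phi> :: "nat \<Rightarrow> real \<Rightarrow> real"
  assumes \<phi>: "\<And>j t. (\<phi> j has_real_derivative \<phi> (Suc j) t) (at t)"
  shows "Ck k u \<Longrightarrow> Ck k (\<lambda>x. \<phi> j (u x))"
proof (induction k arbitrary: j)
  case 0
  have "continuous_on UNIV (\<phi> j)" 
    by (intro continuous_at_imp_continuous_on ballI DERIV_isCont[OF \<phi>])
  then show ?case using 0 continuous_on_compose2[of UNIV "\<phi> j" UNIV u] by simp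
next
  case (Suc k)
  show ?case
  proof (rule Ck_SucI)
    fix x
    show "((\<lambda>x. \<phi> j (u x)) has_derivative (\<lambda>h. \<phi> (Suc j) (u x) * frechet_derivative u (at x) h)) (at x)"
      using has_derivative_compose[OF Ck_has_derivative[OF Suc.prems] \<phi>[unfolded has_field_derivative_def]] .
  next
    fix b :: 'a assume "b \<in> Basis"
    then show "Ck k (\<lambda>x. \<phi> (Suc j) (u x) * frechet_derivative u (at x) b)"
      using Suc.prems by (intro Ck_mult Suc.IH Ck_SucD[OF Suc.prems]) auto
  qed
qed


text \<open>
  The \<open>j\<close>-th derivative of \<open>exp (-1/t)\<close> is \<open>P(1/t) exp (-1/t)\<close> for a polynomial \<open>P\<close>; differentiating once more
  replaces \<open>P\<close> by \<open>X\<^sup>2 (P - P')\<close>.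
\<close>

fun flat_poly :: "nat \<Rightarrow> real poly" where
  "flat_poly 0 = 1"
| "flat_poly (Suc j) = [:0, 0, 1:] * (flat_poly j - pderiv (flat_poly j))"

definition flat_deriv :: "nat \<Rightarrow> real \<Rightarrow> real" where
  "flat_deriv j t = (if t > 0 then poly (flat_poly j) (1 / t) * exp (- (1 / t)) else 0)"

definition flat :: "real \<Rightarrow> real" where
  "flat t = (if t > 0 then exp (- (1 / t)) else 0)"

lemma flat_deriv_0: "flat_deriv 0 = flat"
  by (auto simp: flat_deriv_def flat_def)

lemma poly_div_exp_tendsto_0: "((\<lambda>x. poly p x * exp (- x)) \<longlongrightarrow> (0::real)) at_top"
proof -
  have "((\<lambda>x. \<Sum>i\<le>degree p. coeff p i * (x ^ i / exp x)) \<longlongrightarrow> (\<Sum>i\<le>degree p. coeff p i * 0)) at_top"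
    by (intro tendsto_sum tendsto_mult tendsto_const tendsto_power_div_exp_0)
  then show ?thesis
    by (simp add: poly_altdef exp_minus divide_inverse sum_distrib_right mult.assoc)
qed

text \<open>
  Away from \<open>0\<close> this is the product rule. At \<open>0\<close> the difference quotient from the right is again a polynomial in
  \<open>1/t\<close> times \<open>exp (-1/t)\<close>, hence tends to \<open>0\<close>.
\<close>

lemma flat_deriv_has_derivative: "(flat_deriv j has_real_derivative flat_deriv (Suc j) t) (at t)"
proof -
  consider "t > 0" | "t < 0" | "t = 0" by linarith
  then show ?thesis
  proof cases
    case 1
    have "((\<lambda>t. poly (flat_poly j) (1 / t) * exp (- (1 / t))) has_real_derivative flat_deriv (Suc j) t) (at t)"
      using 1 by (auto intro!: derivative_eq_intros poly_DERIV[THEN DERIV_chain2]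
          simp: flat_deriv_def power2_eq_square field_simps)
    then show ?thesis
      by (rule has_field_derivative_transform_within_open[where S="{0<..}"]) (use 1 in \<open>auto simp: flat_deriv_def\<close>)
  next
    case 2
    have "((\<lambda>t. 0) has_real_derivative flat_deriv (Suc j) t) (at t)"
      using 2 by (simp add: flat_deriv_def)
    then show ?thesis
      by (rule has_field_derivative_transform_within_open[where S="{..<0}"]) (use 2 in \<open>auto simp: flat_deriv_def\<close>)
  next
    case 3
    have "((\<lambda>y. flat_deriv j y / y) \<longlongrightarrow> 0) (at_left 0)"
      by (rule tendsto_eventually) (auto simp: eventually_at_filter flat_deriv_def)
    moreover have "((\<lambda>y. flat_deriv j y / y) \<longlongrightarrow> 0) (at_right 0)"
    proof -
      have "((\<lambda>y::real. poly (pCons 0 (flat_poly j)) (inverse y) * exp (- inverse y)) \<longlongrightarrow> 0) (at_right 0)"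
        by (rule filterlim_compose[OF poly_div_exp_tendsto_0 filterlim_inverse_at_top_right])
      then show ?thesis
        by (rule Lim_transform_eventually) (auto simp: eventually_at_filter flat_deriv_def field_simps)
    qed
    ultimately have "((\<lambda>y. flat_deriv j y / y) \<longlongrightarrow> 0) (at 0)"
      by (simp add: filterlim_at_split)
    then show ?thesis
      using 3 by (simp add: has_field_derivative_iff flat_deriv_def)
  qed
qed

lemma Ck_flat: "Ck k u \<Longrightarrow> Ck k (\<lambda>x. flat (u x))"
  using Ck_compose[of flat_deriv k u 0] flat_deriv_has_derivative by (simp add: flat_deriv_0)

lemma flat_mono: "s \<le> t \<Longrightarrow> flat s \<le> flat t"
  by (auto simp: flat_def frac_le)

lemma flat_nonneg: "0 \<le> flat t" and flat_pos_iff: "0 < flat t \<longleftrightarrow> 0 < t" and flat_nonpos: "t \<le> 0 \<Longrightarrow> flat t = 0"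
  by (auto simp: flat_def)


definition supported_within :: "real \<Rightarrow> ('a::real_normed_vector \<Rightarrow> real) \<Rightarrow> bool" where
  "supported_within \<rho> u \<longleftrightarrow> (\<forall>x. \<rho> < norm x \<longrightarrow> u x = 0)"

lemma supported_withinD: "supported_within \<rho> u \<Longrightarrow> \<rho> < norm x \<Longrightarrow> u x = 0"
  unfolding supported_within_def by blast

lemma frechet_derivative_vanishes:
  assumes "supported_within \<rho> f" "\<And>x. f differentiable (at x)" "norm x > \<rho>"
  shows "frechet_derivative f (at x) = (\<lambda>_. 0)"
proof -
  have "open {x. norm x > \<rho>}" by (intro open_Collect_less continuous_intros)
  then have "frechet_derivative f (at x) = frechet_derivative (\<lambda>_. 0) (at x)"
    using assms by (intro frechet_derivative_transform_within_open[where X="{x. norm x > \<rho>}"])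
      (auto simp: supported_within_def)
  then show ?thesis by simp
qed

lemma bounded_of_compact_support:
  fixes f :: "'a::euclidean_space \<Rightarrow> real"
  assumes "continuous_on UNIV f" "supported_within \<rho> f"
  obtains B where "B \<ge> 0" "\<And>x. \<bar>f x\<bar> \<le> B"
proof -
  have "compact (f ` cball 0 \<rho>)"
    using assms by (intro compact_continuous_image) (auto intro: continuous_on_subset)
  then obtain B where B: "\<And>y. y \<in> f ` cball 0 \<rho> \<Longrightarrow> norm y \<le> B" by (meson bounded_iff compact_imp_bounded)
  have "\<bar>f x\<bar> \<le> max 0 B" for x
    using B[of "f x"] supported_withinD[OF assms(2), of x] by (cases "norm x \<le> \<rho>") (auto simp: le_max_iff_disj)
  then show ?thesis by (intro that[of "max 0 B"]) auto
qed

lemma linear_bound_of_Basis: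
  fixes l :: "'a::euclidean_space \<Rightarrow> real"
  assumes "linear l" "\<And>b. b \<in> Basis \<Longrightarrow> \<bar>l b\<bar> \<le> B"
  shows "\<bar>l h\<bar> \<le> real DIM('a) * B * norm h"
proof -
  have "l h = l (\<Sum>b\<in>Basis. (h \<bullet> b) *\<^sub>R b)" by (simp add: euclidean_representation)
  also have "\<dots> = (\<Sum>b\<in>Basis. (h \<bullet> b) * l b)"
    using assms(1) by (simp add: linear_sum linear_scale)
  finally have "\<bar>l h\<bar> \<le> (\<Sum>b\<in>Basis. \<bar>(h \<bullet> b) * l b\<bar>)" by (simp add: sum_abs)
  also have "\<dots> \<le> (\<Sum>b\<in>(Basis::'a set). norm h * B)"
    using assms(2) by (intro sum_mono) (auto simp: abs_mult intro!: mult_mono Basis_le_norm)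
  finally show ?thesis by (simp add: mult_ac)
qed

lemma lipschitz_of_Ck1:
  fixes f :: "'a::euclidean_space \<Rightarrow> real"
  assumes f: "Ck 1 f" and supp: "supported_within \<rho> f"
  obtains L where "L \<ge> 0" "\<And>x y. \<bar>f x - f y\<bar> \<le> L * norm (x - y)"
proof -
  have d: "(f has_derivative frechet_derivative f (at x)) (at x)" for x
    using f Ck_has_derivative[of 0 f x] by simp
  have "\<exists>B\<ge>0. \<forall>x. \<bar>frechet_derivative f (at x) b\<bar> \<le> B" if "b \<in> Basis" for b
  proof -
    have "continuous_on UNIV (\<lambda>x. frechet_derivative f (at x) b)" using f that by simp
    moreover have "supported_within \<rho> (\<lambda>x. frechet_derivative f (at x) b)"
      using frechet_derivative_vanishes[OF supp] f by (simp add: supported_within_def)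
    ultimately show ?thesis by (rule bounded_of_compact_support) auto
  qed
  then obtain B where B: "\<And>b x. b \<in> Basis \<Longrightarrow> B b \<ge> 0 \<and> \<bar>frechet_derivative f (at x) b\<bar> \<le> B b"
    by metis
  define M where "M = (\<Sum>b\<in>Basis. B b)"
  have M: "M \<ge> 0" "\<And>b. b \<in> Basis \<Longrightarrow> B b \<le> M"
    using B by (auto simp: M_def intro!: sum_nonneg member_le_sum)
  have "onorm (frechet_derivative f (at x)) \<le> real DIM('a) * M" for x
  proof (rule onorm_le)
    fix h
    show "norm (frechet_derivative f (at x) h) \<le> real DIM('a) * M * norm h"
      using linear_bound_of_Basis[OF has_derivative_linear[OF d], where B=M] B M order_trans by fastforce
  qed
  then have "norm (f x - f y) \<le> real DIM('a) * M * norm (x - y)" for x y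
    by (intro differentiable_bound[OF convex_UNIV]) (use d in auto)
  then show ?thesis using M by (intro that[of "real DIM('a) * M"]) auto
qed

section \<open>The fractional gradient and its symmetries\<close>

text \<open>
  The Riesz gradient without its constant, with the singularity of the kernel translated to the
  origin. In this form translations, dilations and isometries act on \<open>u\<close> alone.
\<close>

definition frac_grad :: "real \<Rightarrow> ('a::euclidean_space \<Rightarrow> real) \<Rightarrow> 'a \<Rightarrow> 'a" where
  "frac_grad s u x = (\<integral>z. ((u (x + z) - u x) / norm z powr (real DIM('a) + s + 1)) *\<^sub>R z \<partial>lborel)"

lemma riesz_gradient_eq:
  fixes u :: "'a::euclidean_space \<Rightarrow> real"
  assumes [measurable]: "u \<in> borel_measurable borel"
  shows "riesz_gradient c s u x = c *\<^sub>R frac_grad s u x"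
proof -
  let ?f = "\<lambda>y. ((u y - u x) / norm (y - x) powr (real DIM('a) + s + 1)) *\<^sub>R (y - x)"
  have "integral\<^sup>L lebesgue ?f = integral\<^sup>L lborel ?f" by (rule integral_completion) simp
  also have "\<dots> = (\<integral>z. ?f (z + x) \<partial>lborel)"
    by (rule lborel_integral_translate[symmetric]) simp
  finally show ?thesis by (simp add: riesz_gradient_def frac_grad_def add.commute)
qed

text \<open>
  Lipschitz continuity and boundedness of the oscillation in one inequality. The right-hand side is exactly what makes
  the kernel integrable, both at the origin and at infinity.
\<close>

definition bdd_lipschitz :: "real \<Rightarrow> ('a::euclidean_space \<Rightarrow> real) \<Rightarrow> bool" where
  "bdd_lipschitz M u \<longleftrightarrow> 0 \<le> M \<and> (\<forall>x y. \<bar>u x - u y\<bar> \<le> M * min (norm (x - y)) 1)"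

lemma bdd_lipschitz_continuous:
  fixes u :: "'a::euclidean_space \<Rightarrow> real"
  assumes "bdd_lipschitz M u"
  shows "continuous_on UNIV u"
proof -
  from assms have M: "0 \<le> M" and "\<bar>u x - u y\<bar> \<le> M * min (norm (x - y)) 1" for x y
    by (auto simp: bdd_lipschitz_def)
  moreover have "M * min (norm (x - y)) 1 \<le> M * norm (x - y)" for x y :: 'a
    using M by (intro mult_left_mono) auto
  ultimately have "0 \<le> M" "\<bar>u x - u y\<bar> \<le> M * norm (x - y)" for x y
    by (blast intro: order_trans)+
  then have "M-lipschitz_on UNIV u" by (intro lipschitz_onI) (auto simp: dist_norm)
  then show ?thesis by (rule lipschitz_on_continuous_on)
qed

lemma bdd_lipschitz_measurable: "bdd_lipschitz M u \<Longrightarrow> u \<in> borel_measurable borel"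
  by (intro borel_measurable_continuous_onI bdd_lipschitz_continuous)

lemma bdd_lipschitz_of_Ck1:
  fixes u :: "'a::euclidean_space \<Rightarrow> real"
  assumes "Ck 1 u" "supported_within \<rho> u"
  obtains M where "bdd_lipschitz M u"
proof -
  obtain L where L: "L \<ge> 0" "\<And>x y. \<bar>u x - u y\<bar> \<le> L * norm (x - y)"
    using lipschitz_of_Ck1[OF assms] by blast
  obtain B where B: "B \<ge> 0" "\<And>x. \<bar>u x\<bar> \<le> B"
    using bounded_of_compact_support[of u \<rho>] Ck_SucD[of 0 u] assms by auto
  have "\<bar>u x - u y\<bar> \<le> max L (2 * B) * min (norm (x - y)) 1" for x y
  proof (cases "norm (x - y) \<le> 1")
    case True
    then show ?thesis using L(2)[of x y] mult_right_mono[of L "max L (2 * B)" "norm (x - y)"] by (simp add: min_def)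
  next
    case False
    then show ?thesis using B(2)[of x] B(2)[of y] by (simp add: min_def)
  qed
  then show ?thesis using L(1) by (intro that[of "max L (2 * B)"]) (auto simp: bdd_lipschitz_def)
qed

definition kernel_majorant :: "real \<Rightarrow> 'a::euclidean_space \<Rightarrow> real" where
  "kernel_majorant s z = min (norm z) 1 * norm z powr (- real DIM('a) - s)"

lemma kernel_majorant_nonneg: "0 \<le> kernel_majorant s z"
  by (simp add: kernel_majorant_def)

text \<open>
  Near the origin the majorant is \<open>|z|\<^bsup>1-s-N\<^esup>\<close>, which is integrable since \<open>s < 1\<close>; far away it is
  \<open>|z|\<^bsup>-N-s\<^esup>\<close>, which is integrable since \<open>s > 0\<close>.
\<close>

lemma integrable_kernel_majorant:
  assumes "0 < s" "s < 1"
  shows "integrable lborel (kernel_majorant s :: 'a::euclidean_space \<Rightarrow> real)"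
proof (rule Bochner_Integration.integrable_bound)
  let ?N = "real DIM('a)"
  have N: "?N \<ge> 1" using DIM_ge_Suc0[where 'a='a] by simp
  let ?g = "\<lambda>z::'a. indicator (ball 0 1) z * norm z powr ((1 - s) - ?N)
      + 2 powr (?N + s) * (1 + norm z) powr (- ?N - s)"
  show "integrable lborel ?g"
    by (intro Bochner_Integration.integrable_add integrable_mult_right
      integrable_powr_at_origin integrable_powr_at_infinity; use assms N in linarith)
  show "(kernel_majorant s :: 'a \<Rightarrow> real) \<in> borel_measurable lborel"
    unfolding kernel_majorant_def by measurable
  have "norm (kernel_majorant s z) \<le> norm (?g z)" for z :: 'a
  proof (cases "norm z < 1")
    case True
    have "norm z * norm z powr (- ?N - s) = norm z powr ((1 - s) - ?N)"
      by (cases "z = 0") (simp_all add: powr_mult_base algebra_simps)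
    then show ?thesis using True by (simp add: kernel_majorant_def abs_mult)
  next
    case False
    have "norm z powr (- ?N - s) \<le> ((1 + norm z) / 2) powr (- ?N - s)"
      using False assms N by (intro powr_mono2') auto
    also have "\<dots> = 2 powr (?N + s) * (1 + norm z) powr (- ?N - s)"
    proof -
      have "(2::real) powr (- ?N - s) = 1 / 2 powr (?N + s)"
        using powr_minus_divide[of 2 "?N + s"] by simp
      then show ?thesis by (simp add: powr_divide)
    qed
    finally show ?thesis using False by (simp add: kernel_majorant_def)
  qed
  then show "AE z in lborel. norm (kernel_majorant s (z::'a)) \<le> norm (?g z)" by simp
qed

lemma norm_kernel:
  fixes z :: "'a::euclidean_space"
  shows "norm ((d / norm z powr (real DIM('a) + s + 1)) *\<^sub>R z) = \<bar>d\<bar> * norm z powr (- real DIM('a) - s)"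
proof (cases "z = 0")
  case False
  have "norm z powr (- real DIM('a) - s) = norm z powr (- (real DIM('a) + s + 1) + 1)" by simp
  also have "\<dots> = norm z / norm z powr (real DIM('a) + s + 1)"
    using False by (simp only: powr_add powr_minus) (simp add: field_simps)
  finally show ?thesis by simp
qed simp

lemma norm_kernel_le:
  fixes z :: "'a::euclidean_space"
  assumes "\<bar>d\<bar> \<le> M * min (norm z) 1"
  shows "norm ((d / norm z powr (real DIM('a) + s + 1)) *\<^sub>R z) \<le> M * kernel_majorant s z"
  unfolding norm_kernel kernel_majorant_def using mult_right_mono[OF assms, of "norm z powr (- real DIM('a) - s)"] by (simp add: mult_ac)

lemma kernel_integral:
  fixes d :: "'a::euclidean_space \<Rightarrow> real"
  assumes s: "0 < s" "s < 1" and [measurable]: "d \<in> borel_measurable borel"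
    and d: "\<And>z. \<bar>d z\<bar> \<le> M * min (norm z) 1"
  shows "integrable lborel (\<lambda>z. (d z / norm z powr (real DIM('a) + s + 1)) *\<^sub>R z)"
    and "norm (\<integral>z. (d z / norm z powr (real DIM('a) + s + 1)) *\<^sub>R z \<partial>lborel)
      \<le> M * (\<integral>z. kernel_majorant s (z::'a) \<partial>lborel)"
proof -
  have i: "integrable lborel (\<lambda>z::'a. M * kernel_majorant s z)"
    by (intro integrable_mult_right integrable_kernel_majorant s)
  have le: "norm ((d z / norm z powr (real DIM('a) + s + 1)) *\<^sub>R z) \<le> M * kernel_majorant s z" for z
    by (rule norm_kernel_le[OF d])
  show "integrable lborel (\<lambda>z. (d z / norm z powr (real DIM('a) + s + 1)) *\<^sub>R z)"
  proof (rule Bochner_Integration.integrable_bound[OF i])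
    show "AE z in lborel. norm ((d z / norm z powr (real DIM('a) + s + 1)) *\<^sub>R z) \<le> norm (M * kernel_majorant s z)"
      using le order_trans[OF le abs_ge_self] by simp
  qed measurable
  then have "norm (\<integral>z. (d z / norm z powr (real DIM('a) + s + 1)) *\<^sub>R z \<partial>lborel)
      \<le> (\<integral>z. M * kernel_majorant s (z::'a) \<partial>lborel)"
    by (intro order_trans[OF integral_norm_bound] integral_mono i integrable_norm le)
  then show "norm (\<integral>z. (d z / norm z powr (real DIM('a) + s + 1)) *\<^sub>R z \<partial>lborel)
      \<le> M * (\<integral>z. kernel_majorant s (z::'a) \<partial>lborel)" by simp
qed

lemma bdd_lipschitz_increment:
  assumes "bdd_lipschitz M u"
  shows "\<bar>u (x + z) - u x\<bar> \<le> M * min (norm z) 1" "(\<lambda>z. u (x + z) - u x) \<in> borel_measurable borel"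
proof -
  have [measurable]: "u \<in> borel_measurable borel" by (rule bdd_lipschitz_measurable[OF assms])
  show "(\<lambda>z. u (x + z) - u x) \<in> borel_measurable borel" by measurable
  have "\<bar>u (x + z) - u x\<bar> \<le> M * min (norm (x + z - x)) 1" using assms unfolding bdd_lipschitz_def by blast
  then show "\<bar>u (x + z) - u x\<bar> \<le> M * min (norm z) 1" by simp
qed

lemma frac_grad_integrand_integrable:
  fixes u :: "'a::euclidean_space \<Rightarrow> real"
  assumes "0 < s" "s < 1" "bdd_lipschitz M u"
  shows "integrable lborel (\<lambda>z. ((u (x + z) - u x) / norm z powr (real DIM('a) + s + 1)) *\<^sub>R z)"
  using kernel_integral(1)[OF assms(1,2) bdd_lipschitz_increment(2)[OF assms(3)] bdd_lipschitz_increment(1)[OF assms(3)]] .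

lemma frac_grad_bounded:
  fixes u :: "'a::euclidean_space \<Rightarrow> real"
  assumes "0 < s" "s < 1" "bdd_lipschitz M u"
  shows "norm (frac_grad s u x) \<le> M * (\<integral>z. kernel_majorant s (z::'a) \<partial>lborel)"
  unfolding frac_grad_def
  using kernel_integral(2)[OF assms(1,2) bdd_lipschitz_increment(2)[OF assms(3)] bdd_lipschitz_increment(1)[OF assms(3)]] .

lemma frac_grad_measurable:
  fixes u :: "'a::euclidean_space \<Rightarrow> real"
  assumes [measurable]: "u \<in> borel_measurable borel"
  shows "frac_grad s u \<in> borel_measurable borel"
proof -
  have "(\<lambda>x. \<integral>z. ((u (x + z) - u x) / norm z powr (real DIM('a) + s + 1)) *\<^sub>R z \<partial>lborel) \<in> borel_measurable borel"
    by measurable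
  then show ?thesis by (simp add: frac_grad_def[abs_def])
qed

lemma frac_grad_linear:
  fixes u w :: "'a::euclidean_space \<Rightarrow> real"
  assumes s: "0 < s" "s < 1" and u: "bdd_lipschitz M u" and w: "bdd_lipschitz M' w"
  shows "frac_grad s (\<lambda>x. \<alpha> * u x + \<beta> * w x) x = \<alpha> *\<^sub>R frac_grad s u x + \<beta> *\<^sub>R frac_grad s w x"
proof -
  note iu = frac_grad_integrand_integrable[OF s u, of x] and iw = frac_grad_integrand_integrable[OF s w, of x]
  have "frac_grad s (\<lambda>x. \<alpha> * u x + \<beta> * w x) x
    = (\<integral>z. \<alpha> *\<^sub>R (((u (x + z) - u x) / norm z powr (real DIM('a) + s + 1)) *\<^sub>R z)
      + \<beta> *\<^sub>R (((w (x + z) - w x) / norm z powr (real DIM('a) + s + 1)) *\<^sub>R z) \<partial>lborel)"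
    unfolding frac_grad_def
  proof (intro Bochner_Integration.integral_cong refl)
    fix z :: 'a
    let ?n = "norm z powr (real DIM('a) + s + 1)"
    have "(\<alpha> * u (x + z) + \<beta> * w (x + z) - (\<alpha> * u x + \<beta> * w x)) / ?n
        = \<alpha> * ((u (x + z) - u x) / ?n) + \<beta> * ((w (x + z) - w x) / ?n)"
      by (simp add: algebra_simps add_divide_distrib diff_divide_distrib)
    then show "((\<alpha> * u (x + z) + \<beta> * w (x + z) - (\<alpha> * u x + \<beta> * w x)) / ?n) *\<^sub>R z
        = \<alpha> *\<^sub>R (((u (x + z) - u x) / ?n) *\<^sub>R z) + \<beta> *\<^sub>R (((w (x + z) - w x) / ?n) *\<^sub>R z)"
      by (simp only: scaleR_add_left scaleR_scaleR)
  qed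
  also have "\<dots> = \<alpha> *\<^sub>R frac_grad s u x + \<beta> *\<^sub>R frac_grad s w x"
    unfolding frac_grad_def
    by (simp only: integral_scaleR_right
        Bochner_Integration.integral_add[OF integrable_scaleR_right[OF iu] integrable_scaleR_right[OF iw]])
  finally show ?thesis .
qed

lemma frac_grad_translate: "frac_grad s (\<lambda>x. u (x - a)) x = frac_grad s u (x - a)"
  by (simp add: frac_grad_def algebra_simps)

lemma frac_grad_dilate:
  fixes u :: "'a::euclidean_space \<Rightarrow> real"
  assumes R: "R > 0" and [measurable]: "u \<in> borel_measurable borel"
  shows "frac_grad s (\<lambda>x. u ((1 / R) *\<^sub>R x)) x = R powr (- s) *\<^sub>R frac_grad s u ((1 / R) *\<^sub>R x)"
proof -
  have "frac_grad s (\<lambda>x. u ((1 / R) *\<^sub>R x)) x = R ^ DIM('a) *\<^sub>R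
     (\<integral>z. ((u ((1 / R) *\<^sub>R (x + R *\<^sub>R z)) - u ((1 / R) *\<^sub>R x)) / norm (R *\<^sub>R z) powr (real DIM('a) + s + 1)) *\<^sub>R (R *\<^sub>R z) \<partial>lborel)"
    unfolding frac_grad_def by (rule lborel_integral_scale[OF R]) measurable
  also have "\<dots> = R ^ DIM('a) *\<^sub>R (\<integral>z. (R powr (- real DIM('a) - s)) *\<^sub>R (((u ((1 / R) *\<^sub>R x + z) - u ((1 / R) *\<^sub>R x)) / norm z powr (real DIM('a) + s + 1)) *\<^sub>R z) \<partial>lborel)"
  proof -
    have "(d / norm (R *\<^sub>R z) powr (real DIM('a) + s + 1)) *\<^sub>R (R *\<^sub>R z)
        = (R powr (- real DIM('a) - s)) *\<^sub>R ((d / norm z powr (real DIM('a) + s + 1)) *\<^sub>R z)" for d and z :: 'a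
    proof -
      have "R powr (- real DIM('a) - s) = R powr (- (real DIM('a) + s + 1) + 1)" by simp
      also have "\<dots> = R / R powr (real DIM('a) + s + 1)"
        using R by (simp only: powr_add powr_minus) (simp add: field_simps)
      finally show ?thesis using R by (simp add: powr_mult)
    qed
    moreover have "(1 / R) *\<^sub>R (x + R *\<^sub>R z) = (1 / R) *\<^sub>R x + z" for z
      using R by (simp add: scaleR_add_right)
    ultimately show ?thesis by (simp only:)
  qed
  also have "\<dots> = (R ^ DIM('a) * R powr (- real DIM('a) - s)) *\<^sub>R frac_grad s u ((1 / R) *\<^sub>R x)"
    unfolding frac_grad_def by (subst integral_scaleR_right) (rule scaleR_scaleR)
  also have "R ^ DIM('a) * R powr (- real DIM('a) - s) = R powr (- s)"
    using R by (simp flip: powr_realpow powr_add)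
  finally show ?thesis .
qed

lemma frac_grad_equivariant:
  fixes u :: "'a::euclidean_space \<Rightarrow> real"
  assumes T: "orthogonal_transformation T" and uT: "\<And>x. u (T x) = u x"
    and s: "0 < s" "s < 1" and u: "bdd_lipschitz M u"
  shows "frac_grad s u (T x) = T (frac_grad s u x)"
proof -
  have [measurable]: "u \<in> borel_measurable borel" by (rule bdd_lipschitz_measurable[OF u])
  have lin: "linear T" by (rule orthogonal_transformation_linear[OF T])
  have "frac_grad s u (T x) =
      (\<integral>z. ((u (T x + T z) - u (T x)) / norm (T z) powr (real DIM('a) + s + 1)) *\<^sub>R T z \<partial>lborel)"
    unfolding frac_grad_def
    by (rule lborel_integral_orthogonal[OF T, symmetric]) measurable
  also have "\<dots> = (\<integral>z. T (((u (x + z) - u x) / norm z powr (real DIM('a) + s + 1)) *\<^sub>R z) \<partial>lborel)"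
    by (simp add: uT orthogonal_transformation_norm[OF T] linear_scale[OF lin] flip: linear_add[OF lin])
  also have "\<dots> = T (frac_grad s u x)"
    unfolding frac_grad_def
    by (rule integral_bounded_linear[OF linear_conv_bounded_linear[THEN iffD1, OF lin] frac_grad_integrand_integrable[OF s u]])
  finally show ?thesis .
qed

definition radial :: "('a::real_normed_vector \<Rightarrow> real) \<Rightarrow> bool" where
  "radial u \<longleftrightarrow> (\<forall>x y. norm x = norm y \<longrightarrow> u x = u y)"

lemma radialD: "radial u \<Longrightarrow> norm x = norm y \<Longrightarrow> u x = u y"
  unfolding radial_def by blast

lemma frac_grad_radial_0:
  fixes u :: "'a::euclidean_space \<Rightarrow> real"
  assumes "radial u" "0 < s" "s < 1" "bdd_lipschitz M u"
  shows "frac_grad s u 0 = 0"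
proof -
  have T: "orthogonal_transformation (\<lambda>x::'a. - x)"
    unfolding orthogonal_transformation_def by (auto intro!: linearI)
  have "frac_grad s u (- 0) = - frac_grad s u 0"
    by (rule frac_grad_equivariant[OF T radialD[OF assms(1)] assms(2-4)]) simp
  then have "frac_grad s u 0 + frac_grad s u 0 = 0"
    by (simp only: minus_zero eq_neg_iff_add_eq_0)
  then have "2 *\<^sub>R frac_grad s u 0 = 0" by (simp only: scaleR_2)
  then show ?thesis by simp
qed

text \<open>
  The reflection that fixes \<open>x\<close> and changes the sign on its orthogonal complement leaves \<open>u\<close> invariant, hence fixes the
  gradient at \<open>x\<close>; its fixed vectors are the multiples of \<open>x\<close>.
\<close>

lemma frac_grad_radial:
  fixes u :: "'a::euclidean_space \<Rightarrow> real"
  assumes rad: "radial u" and s: "0 < s" "s < 1" and u: "bdd_lipschitz M u" and x: "x \<noteq> 0"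
  shows "frac_grad s u x = ((frac_grad s u x \<bullet> x) / (x \<bullet> x)) *\<^sub>R x"
proof -
  \<comment> \<open>The reflection across the line spanned by \<open>x\<close>.\<close>
  define T where "T v = (2 * (v \<bullet> x) / (x \<bullet> x)) *\<^sub>R x - v" for v
  have "linear T"
    by (rule linearI) (simp_all add: T_def inner_add_left distrib_left add_divide_distrib scaleR_add_left scaleR_diff_right)
  moreover have "T v \<bullet> T w = v \<bullet> w" for v w
  proof -
    have "T v \<bullet> T w = 2 * (v \<bullet> x) / (x \<bullet> x) * (2 * (w \<bullet> x) / (x \<bullet> x)) * (x \<bullet> x)
        - 2 * (v \<bullet> x) / (x \<bullet> x) * (w \<bullet> x) - 2 * (w \<bullet> x) / (x \<bullet> x) * (v \<bullet> x) + v \<bullet> w"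
      unfolding T_def inner_diff_left inner_diff_right inner_scaleR_left inner_scaleR_right inner_commute[of x w]
      by (simp add: algebra_simps)
    then show ?thesis using x by simp
  qed
  ultimately have T: "orthogonal_transformation T" by (simp add: orthogonal_transformation_def)
  have Tx: "T x = x" using x by (simp add: T_def scaleR_2)
  have eq: "frac_grad s u x = T (frac_grad s u x)"
    using frac_grad_equivariant[OF T radialD[OF rad orthogonal_transformation_norm[OF T]] s u, of x]
    unfolding Tx .
  define F where "F = frac_grad s u x"
  have "F + F = T F + F" unfolding F_def by (rule arg_cong2[OF eq refl])
  also have "\<dots> = 2 *\<^sub>R (((F \<bullet> x) / (x \<bullet> x)) *\<^sub>R x)" by (simp add: T_def)
  finally have "2 *\<^sub>R F = 2 *\<^sub>R (((F \<bullet> x) / (x \<bullet> x)) *\<^sub>R x)" by (simp only: scaleR_2)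
  then have "F = ((F \<bullet> x) / (x \<bullet> x)) *\<^sub>R x" by (rule scaleR_left_imp_eq[rotated]) simp
  then show ?thesis unfolding F_def .
qed

section \<open>Radially decreasing functions: direction and decay\<close>

definition radially_decreasing :: "('a::real_normed_vector \<Rightarrow> real) \<Rightarrow> bool" where
  "radially_decreasing u \<longleftrightarrow> (\<forall>x y. norm y \<le> norm x \<longrightarrow> u x \<le> u y)"

lemma radially_decreasingD: "radially_decreasing u \<Longrightarrow> norm y \<le> norm x \<Longrightarrow> u x \<le> u y"
  unfolding radially_decreasing_def by blast

lemma radially_decreasing_radial: "radially_decreasing u \<Longrightarrow> radial u"
  unfolding radially_decreasing_def radial_def by (simp add: order_antisym)

lemma frac_grad_inner:
  fixes u :: "'a::euclidean_space \<Rightarrow> real"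
  assumes "0 < s" "s < 1" "bdd_lipschitz M u"
  shows "frac_grad s u x \<bullet> w = (\<integral>z. (u (x + z) - u x) / norm z powr (real DIM('a) + s + 1) * (z \<bullet> w) \<partial>lborel)"
    and "integrable lborel (\<lambda>z. (u (x + z) - u x) / norm z powr (real DIM('a) + s + 1) * (z \<bullet> w))"
proof -
  note i = frac_grad_integrand_integrable[OF assms, of x]
  show "integrable lborel (\<lambda>z. (u (x + z) - u x) / norm z powr (real DIM('a) + s + 1) * (z \<bullet> w))"
    using integrable_inner_left[of w, OF i] by simp
  show "frac_grad s u x \<bullet> w = (\<integral>z. (u (x + z) - u x) / norm z powr (real DIM('a) + s + 1) * (z \<bullet> w) \<partial>lborel)"
    unfolding frac_grad_def by (subst integral_inner_left[OF i, symmetric]) simp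
qed

lemma orthogonal_transformation_uminus: "orthogonal_transformation (uminus :: 'a::euclidean_space \<Rightarrow> 'a)"
  unfolding orthogonal_transformation_def by (auto intro!: linearI)

text \<open>
  Averaging the integrand over \<open>z\<close> and \<open>- z\<close> leaves \<open>(u (x + z) - u (x - z)) (z \<bullet> x)\<close> times a positive kernel. If
  \<open>z \<bullet> x \<ge> 0\<close> then \<open>x + z\<close> is farther from the origin than \<open>x - z\<close>, and conversely, so the product is
  never positive.
\<close>

lemma frac_grad_inward:
  fixes u :: "'a::euclidean_space \<Rightarrow> real"
  assumes dec: "radially_decreasing u" and s: "0 < s" "s < 1" and u: "bdd_lipschitz M u"
  shows "frac_grad s u x \<bullet> x \<le> 0"
proof -
  define f where "f = (\<lambda>z. (u (x + z) - u x) / norm z powr (real DIM('a) + s + 1) * (z \<bullet> x))"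
  have i: "integrable lborel f" and J: "frac_grad s u x \<bullet> x = integral\<^sup>L lborel f"
    unfolding f_def by (rule frac_grad_inner(2)[OF s u], rule frac_grad_inner(1)[OF s u])
  have i': "integrable lborel (\<lambda>z. f (- z))"
    by (rule lborel_integrable_orthogonal[OF orthogonal_transformation_uminus i])
  have J': "frac_grad s u x \<bullet> x = (\<integral>z. f (- z) \<partial>lborel)"
    unfolding J using lborel_integral_orthogonal[OF orthogonal_transformation_uminus, of f]
      borel_measurable_integrable[OF i] by simp
  have "f z + f (- z) \<le> 0" for z
  proof -
    have eq: "f z + f (- z) = (u (x + z) - u (x - z)) * (z \<bullet> x) / norm z powr (real DIM('a) + s + 1)"
      by (simp add: f_def algebra_simps diff_divide_distrib)
    have n: "(norm (x + z))\<^sup>2 = (norm (x - z))\<^sup>2 + 4 * (z \<bullet> x)"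
      unfolding power2_norm_eq_inner by (simp add: inner_simps inner_commute)
    have "(u (x + z) - u (x - z)) * (z \<bullet> x) \<le> 0"
    proof (cases "z \<bullet> x \<ge> 0")
      case True
      then have "(norm (x - z))\<^sup>2 \<le> (norm (x + z))\<^sup>2" using n by linarith
      then have "norm (x - z) \<le> norm (x + z)" by (rule power2_le_imp_le) simp
      then have "u (x + z) \<le> u (x - z)" by (rule radially_decreasingD[OF dec])
      then show ?thesis using True by (simp add: mult_nonpos_nonneg)
    next
      case False
      then have "(norm (x + z))\<^sup>2 \<le> (norm (x - z))\<^sup>2" using n by linarith
      then have "norm (x + z) \<le> norm (x - z)" by (rule power2_le_imp_le) simp
      then have "u (x - z) \<le> u (x + z)" by (rule radially_decreasingD[OF dec])
      then show ?thesis using False by (simp add: mult_nonneg_nonpos)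
    qed
    then show ?thesis unfolding eq by (simp add: divide_nonpos_nonneg)
  qed
  then have "(\<integral>z. f z + f (- z) \<partial>lborel) \<le> (\<integral>z. 0 \<partial>(lborel :: 'a measure))"
    using i i' by (intro integral_mono) auto
  then show ?thesis using i i' J J' by simp
qed

text \<open>
  Outside the support only points \<open>x + z\<close> of the support contribute, and for all of them \<open>z\<close> makes an obtuse angle
  with \<open>x\<close>.
\<close>

lemma frac_grad_inward_strict:
  fixes u :: "'a::euclidean_space \<Rightarrow> real"
  assumes nn: "\<And>x. 0 \<le> u x" and pos: "u 0 > 0" and supp: "supported_within \<rho> u"
    and s: "0 < s" "s < 1" and u: "bdd_lipschitz M u" and x: "norm x > \<rho>"
  shows "frac_grad s u x \<bullet> x < 0"
proof -
  have \<rho>: "\<rho> \<ge> 0" using pos supported_withinD[OF supp, of 0] by force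
  define f where "f = (\<lambda>z. (u (x + z) - u x) / norm z powr (real DIM('a) + s + 1) * (z \<bullet> x))"
  have i: "integrable lborel f" and J: "frac_grad s u x \<bullet> x = integral\<^sup>L lborel f"
    unfolding f_def by (rule frac_grad_inner(2)[OF s u], rule frac_grad_inner(1)[OF s u])
  have ux: "u x = 0" by (rule supported_withinD[OF supp x])
  have neg: "f z < 0" if "u (x + z) > 0" for z
  proof -
    have "norm (x + z) \<le> \<rho>" using that supported_withinD[OF supp, of "x + z"] by force
    then have "norm (x + z) * norm x < norm x * norm x" using x \<rho> by (intro mult_strict_right_mono) auto
    then have "(x + z) \<bullet> x < x \<bullet> x"
      using norm_cauchy_schwarz[of "x + z" x] by (simp add: power2_norm_eq_inner[symmetric] power2_eq_square)
    then have zx: "z \<bullet> x < 0" by (simp add: inner_add_left)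
    then have "z \<noteq> 0" by auto
    then show ?thesis using that zx ux by (simp add: f_def mult_pos_neg divide_neg_pos)
  qed
  have le: "f z \<le> 0" for z
    using neg[of z] nn[of "x + z"] ux by (cases "u (x + z) = 0") (auto simp: f_def)
  have "integral\<^sup>L lborel f \<noteq> 0"
  proof
    assume "integral\<^sup>L lborel f = 0"
    then have "AE z in lborel. - f z = 0"
      using i le by (subst integral_nonneg_eq_0_iff_AE[symmetric]) auto
    then have "AE z in lborel. z \<notin> {z. u (x + z) > 0}"
      by eventually_elim (use neg in force)
    moreover have "continuous_on UNIV (\<lambda>z. x + z)" by (intro continuous_intros)
    then have "continuous_on UNIV (\<lambda>z. u (x + z))"
      using continuous_on_compose2[OF bdd_lipschitz_continuous[OF u], of UNIV "\<lambda>z. x + z"] by simp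
    then have "open {z. u (x + z) > 0}" by (intro open_Collect_less continuous_on_const)
    moreover have "- x \<in> {z. u (x + z) > 0}" using pos by simp
    ultimately show False using not_AE_notin_open by blast
  qed
  moreover have "integral\<^sup>L lborel f \<le> 0"
    using integral_mono[OF i, of "\<lambda>_. 0"] le by simp
  ultimately show ?thesis using J by simp
qed

lemma integrable_compact_support:
  fixes u :: "'a::euclidean_space \<Rightarrow> real"
  assumes "continuous_on UNIV u" "supported_within \<rho> u"
  shows "integrable lborel u"
proof -
  have "integrable lborel (\<lambda>x. indicator (cball 0 \<rho>) x *\<^sub>R u x)"
    using assms(1) by (intro borel_integrable_compact) (auto intro: continuous_on_subset)
  also have "(\<lambda>x. indicator (cball 0 \<rho>) x *\<^sub>R u x) = u"
    using supported_withinD[OF assms(2)] by (auto simp: fun_eq_iff indicator_def not_le)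
  finally show ?thesis .
qed

text \<open>
  For \<open>x\<close> far from the support the integrand lives where \<open>|z|\<close> is comparable to \<open>|x|\<close>, so the kernel has size
  \<open>|x|\<^bsup>-N-s\<^esup>\<close> there. On the remaining bounded set of \<open>x\<close> the uniform bound suffices.
\<close>

lemma frac_grad_decay:
  fixes u :: "'a::euclidean_space \<Rightarrow> real"
  assumes s: "0 < s" "s < 1" and u: "bdd_lipschitz M u" and supp: "supported_within \<rho> u"
  obtains C where "C \<ge> 0" "\<And>x. norm (frac_grad s u x) \<le> C * (1 + norm x) powr (- real DIM('a) - s)"
proof -
  define r where "r = max \<rho> 0"
  have supp': "supported_within r u" using supp by (simp add: supported_within_def r_def)
  have r: "r \<ge> 0" by (simp add: r_def)
  let ?e = "- real DIM('a) - s"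
  define K where "K = M * (\<integral>z. kernel_majorant s (z::'a) \<partial>lborel)"
  have M: "M \<ge> 0" using u by (simp add: bdd_lipschitz_def)
  have K: "K \<ge> 0" using M by (simp add: K_def integral_nonneg_AE kernel_majorant_nonneg)
  define A where "A = (\<integral>x. \<bar>u x\<bar> \<partial>lborel)"
  have A: "A \<ge> 0" by (simp add: A_def)
  have cu: "continuous_on UNIV u" by (rule bdd_lipschitz_continuous[OF u])
  have iu: "integrable lborel u" by (rule integrable_compact_support[OF cu supp'])
  \<comment> \<open>The first summand serves for \<open>|x| \<le> 2 r + 1\<close>, the second one for larger \<open>|x|\<close>.\<close>
  define C where "C = K / (2 * r + 2) powr ?e + A * 2 powr - ?e"
  have C: "C \<ge> 0" using K A by (simp add: C_def)
  have bound: "norm (frac_grad s u x) \<le> C * (1 + norm x) powr ?e" for x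
  proof (cases "norm x \<le> 2 * r + 1")
    case True
    have "norm (frac_grad s u x) \<le> K / (2 * r + 2) powr ?e * (2 * r + 2) powr ?e"
      using frac_grad_bounded[OF s u, of x] r by (simp add: K_def)
    also have "\<dots> \<le> K / (2 * r + 2) powr ?e * (1 + norm x) powr ?e"
      using True s K by (intro mult_left_mono powr_mono2') (auto simp: add_pos_nonneg)
    also have "\<dots> \<le> C * (1 + norm x) powr ?e"
      using A by (intro mult_right_mono) (auto simp: C_def)
    finally show ?thesis .
  next
    case False
    have ux: "u x = 0" using False r by (intro supported_withinD[OF supp']) auto
    have iu': "integrable lborel (\<lambda>z. u (x + z))"
      using lborel_integrable_translate[OF iu, of x] by (simp add: add.commute)
    have le: "norm (((u (x + z) - u x) / norm z powr (real DIM('a) + s + 1)) *\<^sub>R z)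
        \<le> \<bar>u (x + z)\<bar> * ((1 + norm x) / 2) powr ?e" for z
    proof (cases "u (x + z) = 0")
      case nz: False
      then have "norm (x + z) \<le> r" using supported_withinD[OF supp', of "x + z"] by force
      moreover have "norm x \<le> norm (x + z) + norm z"
        using norm_triangle_ineq4[of "x + z" z] by simp
      ultimately have "(1 + norm x) / 2 \<le> norm z" using False by simp
      then have "norm z powr ?e \<le> ((1 + norm x) / 2) powr ?e"
        using s by (intro powr_mono2') (auto simp: add_pos_nonneg)
      then show ?thesis unfolding norm_kernel ux by (simp add: mult_left_mono)
    qed (simp add: ux)
    have "norm (frac_grad s u x) \<le> (\<integral>z. \<bar>u (x + z)\<bar> * ((1 + norm x) / 2) powr ?e \<partial>lborel)"
      unfolding frac_grad_def
      using iu' by (intro order_trans[OF integral_norm_bound] integral_mono le integrable_norm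
          frac_grad_integrand_integrable[OF s u] integrable_mult_left integrable_abs)
    also have "\<dots> = (\<integral>z. \<bar>u (x + z)\<bar> \<partial>lborel) * ((1 + norm x) / 2) powr ?e" by simp
    also have "(\<integral>z. \<bar>u (x + z)\<bar> \<partial>lborel) = A"
      unfolding A_def using lborel_integral_translate[of "\<lambda>z. \<bar>u z\<bar>" x] bdd_lipschitz_measurable[OF u]
      by (simp add: add.commute)
    also have "((1 + norm x) / 2) powr ?e = 2 powr - ?e * (1 + norm x) powr ?e"
      unfolding powr_minus_divide[of 2 ?e] by (simp add: powr_divide)
    also have "A * (2 powr - ?e * (1 + norm x) powr ?e) \<le> C * (1 + norm x) powr ?e"
      unfolding mult.assoc[symmetric] using K by (intro mult_right_mono) (auto simp: C_def)
    finally show ?thesis .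
  qed
  show ?thesis by (rule that[OF C bound])
qed

lemma decay_integrable_powr:
  fixes F :: "'a::euclidean_space \<Rightarrow> 'b::{banach, second_countable_topology}"
  assumes [measurable]: "F \<in> borel_measurable borel" and s: "s > 0" and p: "p \<ge> 1"
    and C: "C \<ge> 0" "\<And>x. norm (F x) \<le> C * (1 + norm x) powr (- real DIM('a) - s)"
  shows "integrable lborel (\<lambda>x. norm (F x) powr p)"
proof (rule Bochner_Integration.integrable_bound)
  show "integrable lborel (\<lambda>x::'a. C powr p * (1 + norm x) powr (- real DIM('a) - s))"
    using s by (intro integrable_mult_right integrable_powr_at_infinity)
  have "norm (F x) powr p \<le> C powr p * (1 + norm x) powr (- real DIM('a) - s)" for x
  proof -
    have "norm (F x) powr p \<le> (C * (1 + norm x) powr (- real DIM('a) - s)) powr p"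
      using p C by (intro powr_mono2) auto
    also have "\<dots> = C powr p * ((1 + norm x) powr (- real DIM('a) - s)) powr p"
      using C by (simp add: powr_mult)
    also have "((1 + norm x) powr (- real DIM('a) - s)) powr p \<le> (1 + norm x) powr (- real DIM('a) - s)"
    proof -
      have "(1 + norm x) powr (- real DIM('a) - s) \<le> 1"
        using powr_mono[of "- real DIM('a) - s" 0 "1 + norm x"] s by (simp split: if_splits)
      then have "((1 + norm x) powr (- real DIM('a) - s)) powr p \<le> ((1 + norm x) powr (- real DIM('a) - s)) powr 1"
        using p by (intro powr_mono') auto
      then show ?thesis by simp
    qed
    finally show ?thesis by (simp add: mult_left_mono)
  qed
  then show "AE x in lborel. norm (norm (F x) powr p) \<le> norm (C powr p * (1 + norm x) powr (- real DIM('a) - s))"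
    using C by simp
qed measurable

section \<open>Regularity of the fractional gradient and its derivative at the origin\<close>

abbreviation "D u x \<equiv> frechet_derivative u (at x)"

lemma frechet_derivative_bdd_lipschitz:
  fixes u :: "'a::euclidean_space \<Rightarrow> real"
  assumes u: "Ck 2 u" and supp: "supported_within \<rho> u"
  shows "\<exists>M\<ge>0. \<forall>x y h. \<bar>D u x h - D u y h\<bar> \<le> M * norm h * min (norm (x - y)) 1"
proof -
  have u2: "Ck (Suc (Suc 0)) u" using u by (simp only: numeral_2_eq_2)
  have d: "(u has_derivative D u x) (at x)" for x by (rule Ck_has_derivative[OF u2])
  have "\<exists>m. bdd_lipschitz m (\<lambda>x. D u x b)" if "b \<in> Basis" for b
  proof -
    have c: "Ck 1 (\<lambda>x. D u x b)" using u2 that by (simp only: Ck.simps(2)[of "Suc 0"] One_nat_def)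
    have z: "supported_within \<rho> (\<lambda>x. D u x b)"
      by (simp add: supported_within_def frechet_derivative_vanishes[OF supp differentiableI[OF d]])
    obtain M where "bdd_lipschitz M (\<lambda>x. D u x b)" by (rule bdd_lipschitz_of_Ck1[OF c z])
    then show ?thesis by (rule exI)
  qed
  then obtain m where m: "\<And>b. b \<in> Basis \<Longrightarrow> bdd_lipschitz (m b) (\<lambda>x. D u x b)" by metis
  define K where "K = (\<Sum>b\<in>Basis. m b)"
  have K: "K \<ge> 0" "\<And>b. b \<in> Basis \<Longrightarrow> m b \<le> K"
    using m by (auto simp: K_def bdd_lipschitz_def intro!: sum_nonneg member_le_sum)
  have "\<bar>D u x h - D u y h\<bar> \<le> real DIM('a) * K * norm h * min (norm (x - y)) 1" for x y h
  proof -
    have "\<bar>D u x h - D u y h\<bar> \<le> real DIM('a) * (K * min (norm (x - y)) 1) * norm h"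
    proof (rule linear_bound_of_Basis)
      show "linear (\<lambda>h. D u x h - D u y h)"
        by (intro linear_compose_sub has_derivative_linear[OF d])
      fix b :: 'a assume b: "b \<in> Basis"
      have "\<bar>D u x b - D u y b\<bar> \<le> m b * min (norm (x - y)) 1"
        using m[OF b] unfolding bdd_lipschitz_def by blast
      also have "\<dots> \<le> K * min (norm (x - y)) 1" by (intro mult_right_mono K(2) b) auto
      finally show "\<bar>D u x b - D u y b\<bar> \<le> K * min (norm (x - y)) 1" .
    qed
    then show ?thesis by (simp add: mult_ac)
  qed
  then show ?thesis using K by (intro exI[of _ "real DIM('a) * K"]) auto
qed

text \<open>
  The mean value theorem for \<open>x \<mapsto> u (x + z) - u x\<close>, whose derivative is small for small \<open>z\<close> because the derivative
  of \<open>u\<close> is Lipschitz. This bound gives both the Lipschitz continuity of the fractional gradient and the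
  majorant for differentiating it.
\<close>

lemma second_increment_bound:
  fixes u :: "'a::euclidean_space \<Rightarrow> real"
  assumes d: "\<And>x. (u has_derivative D u x) (at x)"
    and M: "M \<ge> 0" "\<And>x y h. \<bar>D u x h - D u y h\<bar> \<le> M * norm h * min (norm (x - y)) 1"
  shows "\<bar>(u (x + z) - u x) - (u (y + z) - u y)\<bar> \<le> M * norm (x - y) * min (norm z) 1"
proof -
  have der: "((\<lambda>x. u (x + z) - u x) has_derivative (\<lambda>h. D u (x + z) h - D u x h)) (at x)" for x
  proof -
    have "((\<lambda>x. x + z) has_derivative (\<lambda>h. h)) (at x)" by (auto intro!: derivative_eq_intros)
    from has_derivative_diff[OF has_derivative_compose[OF this d] d[of x]] show ?thesis .
  qed
  have on: "onorm (\<lambda>h. D u (x + z) h - D u x h) \<le> M * min (norm z) 1" for x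
  proof (rule onorm_le)
    fix h
    show "norm (D u (x + z) h - D u x h) \<le> M * min (norm z) 1 * norm h"
      using M(2)[of "x + z" h x] by (simp add: mult_ac)
  qed
  have "norm ((u (x + z) - u x) - (u (y + z) - u y)) \<le> (M * min (norm z) 1) * norm (x - y)"
    by (rule differentiable_bound[OF convex_UNIV der on]) auto
  then show ?thesis by (simp add: mult_ac)
qed

lemma frac_grad_diff:
  fixes u :: "'a::euclidean_space \<Rightarrow> real"
  assumes s: "0 < s" "s < 1" and u: "bdd_lipschitz M u"
  shows "frac_grad s u x - frac_grad s u y
    = (\<integral>z. (((u (x + z) - u x) - (u (y + z) - u y)) / norm z powr (real DIM('a) + s + 1)) *\<^sub>R z \<partial>lborel)"
  unfolding frac_grad_def diff_divide_distrib[of "u (x + _) - u x"] scaleR_diff_left[of "(u (x + _) - u x) / _"]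
  by (rule Bochner_Integration.integral_diff[OF frac_grad_integrand_integrable[OF s u] frac_grad_integrand_integrable[OF s u], symmetric])

lemma frac_grad_lipschitz:
  fixes u :: "'a::euclidean_space \<Rightarrow> real"
  assumes s: "0 < s" "s < 1" and u: "Ck 2 u" and supp: "supported_within \<rho> u"
  obtains L where "L \<ge> 0" "\<And>x y. norm (frac_grad s u x - frac_grad s u y) \<le> L * norm (x - y)"
proof -
  have u2: "Ck (Suc (Suc 0)) u" using u by (simp only: numeral_2_eq_2)
  have d: "(u has_derivative D u x) (at x)" for x by (rule Ck_has_derivative[OF u2])
  obtain M' where bl: "bdd_lipschitz M' u"
    by (rule bdd_lipschitz_of_Ck1[OF Ck_SucD[OF u2, folded One_nat_def] supp])
  obtain M where M: "M \<ge> 0" "\<And>x y h. \<bar>D u x h - D u y h\<bar> \<le> M * norm h * min (norm (x - y)) 1"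
    using frechet_derivative_bdd_lipschitz[OF u supp] by auto
  have [measurable]: "u \<in> borel_measurable borel" by (rule bdd_lipschitz_measurable[OF bl])
  define I where "I = (\<integral>z. kernel_majorant s (z::'a) \<partial>lborel)"
  have I: "I \<ge> 0" by (simp add: I_def integral_nonneg_AE kernel_majorant_nonneg)
  have "norm (frac_grad s u x - frac_grad s u y) \<le> M * norm (x - y) * I" for x y
    unfolding frac_grad_diff[OF s bl] I_def
    by (rule kernel_integral(2)[OF s]) (auto intro: second_increment_bound[OF d M])
  then show ?thesis using M(1) I by (intro that[of "M * I"]) (auto simp: mult_ac)
qed

lemma times_eta: "(\<lambda>t. t * c) = (*) (c::real)"
  by (simp add: fun_eq_iff mult.commute)

lemma directional_quotient_tendsto:
  fixes u :: "'a::euclidean_space \<Rightarrow> real"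
  assumes "(u has_derivative u') (at z)"
  shows "(\<lambda>n. real (Suc n) * (u ((1 / real (Suc n)) *\<^sub>R x + z) - u z)) \<longlonglongrightarrow> u' x"
proof -
  have l: "linear u'" by (rule has_derivative_linear[OF assms])
  have "((\<lambda>t. t *\<^sub>R x + z) has_derivative (\<lambda>t. t *\<^sub>R x)) (at 0)" by (auto intro!: derivative_eq_intros)
  then have "((\<lambda>t. u (t *\<^sub>R x + z)) has_derivative (\<lambda>t. u' (t *\<^sub>R x))) (at 0)"
    using has_derivative_compose[of "\<lambda>t. t *\<^sub>R x + z" _ 0 UNIV u u'] assms by simp
  then have "((\<lambda>t. u (t *\<^sub>R x + z)) has_real_derivative u' x) (at 0)"
    by (simp add: has_field_derivative_def linear_scale[OF l] times_eta)
  then have "((\<lambda>t. (u (t *\<^sub>R x + z) - u z) / t) \<longlongrightarrow> u' x) (at 0)"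
    by (simp add: has_field_derivative_iff)
  moreover have "filterlim (\<lambda>n. 1 / real (Suc n)) (at 0) sequentially"
    using LIMSEQ_inverse_real_of_nat by (auto simp: filterlim_at inverse_eq_divide)
  ultimately have "(\<lambda>n. (u ((1 / real (Suc n)) *\<^sub>R x + z) - u z) / (1 / real (Suc n))) \<longlonglongrightarrow> u' x"
    by (rule filterlim_compose)
  then show ?thesis by (simp add: mult.commute)
qed

text \<open>
  The differential of the fractional gradient at the origin, applied to \<open>x\<close>. It is the fractional gradient,
  at the origin, of the derivative of \<open>u\<close> in the direction \<open>x\<close>.
\<close>

definition frac_grad_deriv :: "real \<Rightarrow> ('a::euclidean_space \<Rightarrow> real) \<Rightarrow> 'a \<Rightarrow> 'a" where
  "frac_grad_deriv s u x = (\<integral>z. ((D u z x - D u 0 x) / norm z powr (real DIM('a) + s + 1)) *\<^sub>R z \<partial>lborel)"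

text \<open>
  As the fractional gradient vanishes at the origin, the left-hand side is a difference quotient. Its integrand is
  dominated by \<open>second_increment_bound\<close>, uniformly in the step size.
\<close>

lemma frac_grad_deriv_tendsto:
  fixes u :: "'a::euclidean_space \<Rightarrow> real"
  assumes s: "0 < s" "s < 1" and u: "Ck 2 u" and supp: "supported_within \<rho> u" and rad: "radial u"
  shows "(\<lambda>n. real (Suc n) *\<^sub>R frac_grad s u ((1 / real (Suc n)) *\<^sub>R x)) \<longlonglongrightarrow> frac_grad_deriv s u x"
proof -
  have u2: "Ck (Suc (Suc 0)) u" using u by (simp only: numeral_2_eq_2)
  have d: "(u has_derivative D u x) (at x)" for x by (rule Ck_has_derivative[OF u2])
  obtain M' where bl: "bdd_lipschitz M' u"
    by (rule bdd_lipschitz_of_Ck1[OF Ck_SucD[OF u2, folded One_nat_def] supp])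
  obtain M where M: "M \<ge> 0" "\<And>x y h. \<bar>D u x h - D u y h\<bar> \<le> M * norm h * min (norm (x - y)) 1"
    using frechet_derivative_bdd_lipschitz[OF u supp] by auto
  have [measurable]: "u \<in> borel_measurable borel" by (rule bdd_lipschitz_measurable[OF bl])
  have F0: "frac_grad s u 0 = 0" by (rule frac_grad_radial_0[OF rad s bl])
  define q where "q = (\<lambda>n z. real (Suc n) * ((u ((1 / real (Suc n)) *\<^sub>R x + z) - u ((1 / real (Suc n)) *\<^sub>R x)) - (u (0 + z) - u 0)))"
  have q_meas: "q n \<in> borel_measurable borel" for n unfolding q_def by measurable
  have q_lim: "(\<lambda>n. q n z) \<longlonglongrightarrow> D u z x - D u 0 x" for z
  proof -
    have "(\<lambda>n. real (Suc n) * (u ((1 / real (Suc n)) *\<^sub>R x + z) - u z)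
        - real (Suc n) * (u ((1 / real (Suc n)) *\<^sub>R x + 0) - u 0)) \<longlonglongrightarrow> D u z x - D u 0 x"
      by (intro tendsto_diff directional_quotient_tendsto d)
    then show ?thesis by (simp add: q_def algebra_simps)
  qed
  have q_bd: "\<bar>q n z\<bar> \<le> M * norm x * min (norm z) 1" for n z
  proof -
    have "\<bar>q n z\<bar> = real (Suc n) * \<bar>(u ((1 / real (Suc n)) *\<^sub>R x + z) - u ((1 / real (Suc n)) *\<^sub>R x)) - (u (0 + z) - u 0)\<bar>"
      by (simp only: q_def abs_mult abs_of_nat)
    also have "\<dots> \<le> real (Suc n) * (M * norm ((1 / real (Suc n)) *\<^sub>R x - 0) * min (norm z) 1)"
      by (intro mult_left_mono second_increment_bound[OF d M]) simp
    also have "\<dots> = M * norm x * min (norm z) 1" by simp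
    finally show ?thesis .
  qed
  have eq: "real (Suc n) *\<^sub>R frac_grad s u ((1 / real (Suc n)) *\<^sub>R x)
      = (\<integral>z. (q n z / norm z powr (real DIM('a) + s + 1)) *\<^sub>R z \<partial>lborel)" for n
  proof -
    have "real (Suc n) *\<^sub>R frac_grad s u ((1 / real (Suc n)) *\<^sub>R x)
        = real (Suc n) *\<^sub>R (frac_grad s u ((1 / real (Suc n)) *\<^sub>R x) - frac_grad s u 0)"
      by (simp only: F0 diff_zero)
    also have "\<dots> = (\<integral>z. real (Suc n) *\<^sub>R ((((u ((1 / real (Suc n)) *\<^sub>R x + z) - u ((1 / real (Suc n)) *\<^sub>R x)) - (u (0 + z) - u 0))
        / norm z powr (real DIM('a) + s + 1)) *\<^sub>R z) \<partial>lborel)"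
      unfolding frac_grad_diff[OF s bl] by (rule integral_scaleR_right[symmetric])
    finally show ?thesis by (simp only: q_def scaleR_scaleR times_divide_eq_right)
  qed
  have Du_meas: "(\<lambda>z. D u z x - D u 0 x) \<in> borel_measurable borel"
    by (rule borel_measurable_LIMSEQ_real[OF q_lim q_meas])
  show ?thesis unfolding eq frac_grad_deriv_def
  proof (rule integral_dominated_convergence)
    show "integrable lborel (\<lambda>z::'a. M * norm x * kernel_majorant s z)"
      by (intro integrable_mult_right integrable_kernel_majorant s)
    show "AE z in lborel. (\<lambda>n. (q n z / norm z powr (real DIM('a) + s + 1)) *\<^sub>R z)
        \<longlonglongrightarrow> ((D u z x - D u 0 x) / norm z powr (real DIM('a) + s + 1)) *\<^sub>R z"
    proof (rule AE_I2)
      fix z :: 'a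
      show "(\<lambda>n. (q n z / norm z powr (real DIM('a) + s + 1)) *\<^sub>R z)
        \<longlonglongrightarrow> ((D u z x - D u 0 x) / norm z powr (real DIM('a) + s + 1)) *\<^sub>R z"
        unfolding divide_inverse by (intro tendsto_scaleR tendsto_mult q_lim tendsto_const)
    qed
    show "AE z in lborel. norm ((q n z / norm z powr (real DIM('a) + s + 1)) *\<^sub>R z) \<le> M * norm x * kernel_majorant s z" for n
      by (intro AE_I2 norm_kernel_le q_bd)
    show "(\<lambda>z. (q n z / norm z powr (real DIM('a) + s + 1)) *\<^sub>R z) \<in> borel_measurable lborel" for n
      using q_meas[of n] by measurable
    show "(\<lambda>z. ((D u z x - D u 0 x) / norm z powr (real DIM('a) + s + 1)) *\<^sub>R z) \<in> borel_measurable lborel"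
      using Du_meas by measurable
  qed
qed

section \<open>Linear behaviour at the origin\<close>

lemma frechet_derivative_radially_decreasing:
  fixes u :: "'a::euclidean_space \<Rightarrow> real"
  assumes d: "\<And>x. (u has_derivative D u x) (at x)" and dec: "radially_decreasing u"
  shows "D u 0 = (\<lambda>_. 0)" and "D u z z \<le> 0"
proof -
  have "eventually (\<lambda>y. u y \<le> u 0) (at 0)"
    by (intro always_eventually allI radially_decreasingD[OF dec]) simp
  then show "D u 0 = (\<lambda>_. 0)" by (rule has_derivative_local_max[OF d])
  have "((\<lambda>t. t *\<^sub>R z) has_derivative (\<lambda>t. t *\<^sub>R z)) (at 1)" by (auto intro!: derivative_eq_intros)
  then have "((\<lambda>t. u (t *\<^sub>R z)) has_derivative (\<lambda>t. D u (1 *\<^sub>R z) (t *\<^sub>R z))) (at 1)"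
    using d[of "1 *\<^sub>R z"] by (rule has_derivative_compose)
  then have der: "((\<lambda>t. u (t *\<^sub>R z)) has_real_derivative D u z z) (at 1)"
    by (simp add: has_field_derivative_def linear_scale[OF has_derivative_linear[OF d]] times_eta)
  show "D u z z \<le> 0"
  proof (rule ccontr)
    assume "\<not> D u z z \<le> 0"
    then obtain e where e: "e > 0" "\<And>h. 0 < h \<Longrightarrow> h < e \<Longrightarrow> u (1 *\<^sub>R z) < u ((1 + h) *\<^sub>R z)"
      using DERIV_pos_inc_right[OF der] by auto
    have "u ((1 + e / 2) *\<^sub>R z) \<le> u (1 *\<^sub>R z)"
      using e(1) by (intro radially_decreasingD[OF dec]) (simp add: mult_left_le_one_le mult_le_cancel_right1)
    then show False using e(2)[of "e / 2"] e(1) by simp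
  qed
qed

lemma frac_grad_deriv_integrable:
  fixes u :: "'a::euclidean_space \<Rightarrow> real"
  assumes s: "0 < s" "s < 1" and u: "Ck 2 u" and supp: "supported_within \<rho> u"
  shows "integrable lborel (\<lambda>z. ((D u z x - D u 0 x) / norm z powr (real DIM('a) + s + 1)) *\<^sub>R z)"
proof -
  have u2: "Ck (Suc (Suc 0)) u" using u by (simp only: numeral_2_eq_2)
  have d: "(u has_derivative D u x) (at x)" for x by (rule Ck_has_derivative[OF u2])
  obtain M where M: "M \<ge> 0" "\<And>x y h. \<bar>D u x h - D u y h\<bar> \<le> M * norm h * min (norm (x - y)) 1"
    using frechet_derivative_bdd_lipschitz[OF u supp] by auto
  have bd: "\<bar>D u z x - D u 0 x\<bar> \<le> M * norm x * min (norm z) 1" for z using M(2)[of z x 0] by simp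
  have "(M * norm x)-lipschitz_on UNIV (\<lambda>z. D u z x)"
  proof (rule lipschitz_onI)
    fix y z :: 'a
    have "\<bar>D u y x - D u z x\<bar> \<le> M * norm x * min (norm (y - z)) 1" by (rule M(2))
    also have "\<dots> \<le> M * norm x * norm (y - z)" using M(1) by (intro mult_left_mono) auto
    finally show "dist (D u y x) (D u z x) \<le> M * norm x * dist y z" by (simp add: dist_norm)
  qed (use M(1) in simp)
  then have "(\<lambda>z. D u z x - D u 0 x) \<in> borel_measurable borel"
    by (intro borel_measurable_diff borel_measurable_const borel_measurable_continuous_onI lipschitz_on_continuous_on)
  then show ?thesis by (rule kernel_integral(1)[OF s _ bd])
qed

lemma frac_grad_deriv_linear:
  fixes u :: "'a::euclidean_space \<Rightarrow> real"
  assumes s: "0 < s" "s < 1" and u: "Ck 2 u" and supp: "supported_within \<rho> u"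
  shows "linear (frac_grad_deriv s u)"
proof -
  have u2: "Ck (Suc (Suc 0)) u" using u by (simp only: numeral_2_eq_2)
  have l: "linear (D u x)" for x by (rule has_derivative_linear[OF Ck_has_derivative[OF u2]])
  note i = frac_grad_deriv_integrable[OF s u supp]
  show ?thesis
  proof (rule linearI)
    fix x y :: 'a and c :: real
    have "(D u z (x + y) - D u 0 (x + y)) / n = (D u z x - D u 0 x) / n + (D u z y - D u 0 y) / n" for z n
      by (simp add: linear_add[OF l] add_divide_distrib diff_divide_distrib)
    then show "frac_grad_deriv s u (x + y) = frac_grad_deriv s u x + frac_grad_deriv s u y"
      unfolding frac_grad_deriv_def by (simp only: scaleR_add_left Bochner_Integration.integral_add[OF i i])
    have "(D u z (c *\<^sub>R x) - D u 0 (c *\<^sub>R x)) / n = c * ((D u z x - D u 0 x) / n)" for z n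
      by (simp add: linear_scale[OF l] algebra_simps diff_divide_distrib)
    then show "frac_grad_deriv s u (c *\<^sub>R x) = c *\<^sub>R frac_grad_deriv s u x"
      unfolding frac_grad_deriv_def by (simp only: scaleR_scaleR[symmetric] integral_scaleR_right)
  qed
qed

text \<open>
  A linear map for which every vector is an eigenvector is a multiple of the identity. Orthogonality of
  \<open>b - c\<close> and \<open>b + c\<close> for unit basis vectors \<open>b\<close>, \<open>c\<close> shows that the diagonal entries agree; the trace is recorded
  because it determines the factor.
\<close>

lemma linear_collinear_imp_scaleR:
  fixes L :: "'a::euclidean_space \<Rightarrow> 'a"
  assumes lin: "linear L" and orth: "\<And>x w. w \<bullet> x = 0 \<Longrightarrow> L x \<bullet> w = 0"
  shows "\<exists>k. (\<forall>x. L x = k *\<^sub>R x) \<and> (\<Sum>b\<in>Basis. L b \<bullet> b) = k * real DIM('a)"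
proof -
  obtain b0 :: 'a where b0: "b0 \<in> Basis" using nonempty_Basis by blast
  define k where "k = L b0 \<bullet> b0"
  have diag: "L b \<bullet> b = k" if b: "b \<in> Basis" for b
  proof (cases "b = b0")
    case False
    have "(b - b0) \<bullet> (b + b0) = 0" using b b0 by (simp add: inner_simps inner_commute)
    then have "L (b + b0) \<bullet> (b - b0) = 0" by (rule orth)
    moreover have "L b \<bullet> b0 = 0" "L b0 \<bullet> b = 0"
      using b b0 False by (auto intro!: orth simp: inner_not_same_Basis)
    ultimately show ?thesis by (simp add: linear_add[OF lin] inner_simps k_def)
  qed (simp add: k_def)
  have Lb: "L b = k *\<^sub>R b" if b: "b \<in> Basis" for b
  proof (rule euclidean_eqI)
    fix c :: 'a assume c: "c \<in> Basis"
    show "L b \<bullet> c = (k *\<^sub>R b) \<bullet> c"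
      using b c diag[OF b] orth[of c b] by (cases "c = b") (auto simp: inner_not_same_Basis)
  qed
  have "L x = k *\<^sub>R x" for x
  proof -
    have "L x = L (\<Sum>b\<in>Basis. (x \<bullet> b) *\<^sub>R b)" by (simp add: euclidean_representation)
    also have "\<dots> = (\<Sum>b\<in>Basis. (x \<bullet> b) *\<^sub>R L b)" by (simp only: linear_sum[OF lin] linear_scale[OF lin])
    also have "\<dots> = (\<Sum>b\<in>Basis. k *\<^sub>R ((x \<bullet> b) *\<^sub>R b))" by (intro sum.cong refl) (simp add: Lb)
    also have "\<dots> = k *\<^sub>R x" by (simp only: scaleR_sum_right[symmetric] euclidean_representation)
    finally show ?thesis .
  qed
  moreover have "(\<Sum>b\<in>Basis. L b \<bullet> b) = k * real DIM('a)" using diag by simp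
  ultimately show ?thesis by blast
qed

text \<open>
  Summing over an orthonormal basis turns the integrand into the radial derivative \<open>D u z z\<close> times a positive
  kernel; the term with \<open>D u 0\<close> drops out because \<open>u\<close> has its maximum at the origin. The radial
  derivative is nonpositive, and negative somewhere because \<open>u\<close> falls from a positive value to \<open>0\<close> along a ray.
\<close>

lemma frac_grad_deriv_trace_neg:
  fixes u :: "'a::euclidean_space \<Rightarrow> real"
  assumes s: "0 < s" "s < 1" and u: "Ck 2 u" and supp: "supported_within \<rho> u"
    and dec: "radially_decreasing u" and pos: "u 0 > 0"
  shows "(\<Sum>b\<in>Basis. frac_grad_deriv s u b \<bullet> b) < 0"
proof -
  have u2: "Ck (Suc (Suc 0)) u" using u by (simp only: numeral_2_eq_2)
  have d: "(u has_derivative D u x) (at x)" for x by (rule Ck_has_derivative[OF u2])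
  have l: "linear (D u x)" for x by (rule has_derivative_linear[OF d])
  note D0 = frechet_derivative_radially_decreasing(1)[OF d dec]
  note Dz = frechet_derivative_radially_decreasing(2)[OF d dec]
  have Dsum: "(\<Sum>b\<in>Basis. D u z b * (z \<bullet> b)) = D u z z" for z
  proof -
    have "D u z z = D u z (\<Sum>b\<in>Basis. (z \<bullet> b) *\<^sub>R b)" by (simp only: euclidean_representation)
    also have "\<dots> = (\<Sum>b\<in>Basis. (z \<bullet> b) * D u z b)"
      by (simp only: linear_sum[OF l] linear_scale[OF l] real_scaleR_def)
    finally show ?thesis by (simp add: mult.commute)
  qed
  define g where "g = (\<lambda>b z::'a. (D u z b / norm z powr (real DIM('a) + s + 1)) *\<^sub>R z)"
  have gi: "integrable lborel (g b)" for b
    using frac_grad_deriv_integrable[OF s u supp, of b] by (simp add: g_def D0)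
  have gI: "frac_grad_deriv s u b = integral\<^sup>L lborel (g b)" for b
    by (simp add: frac_grad_deriv_def g_def D0)
  define f where "f = (\<lambda>z::'a. D u z z / norm z powr (real DIM('a) + s + 1))"
  have fg: "f z = (\<Sum>b\<in>Basis. g b z \<bullet> b)" for z
    unfolding f_def g_def Dsum[symmetric] by (simp add: sum_divide_distrib)
  have fi: "integrable lborel f"
    unfolding fg[abs_def] by (intro Bochner_Integration.integrable_sum integrable_inner_left gi)
  have fI: "(\<Sum>b\<in>Basis. frac_grad_deriv s u b \<bullet> b) = integral\<^sup>L lborel f"
    unfolding fg[abs_def] gI
    by (subst Bochner_Integration.integral_sum) (auto intro!: integrable_inner_left gi simp: integral_inner_left[OF gi])
  have f_le: "f z \<le> 0" for z using Dz[of z] by (simp add: f_def divide_nonpos_nonneg)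
  obtain b :: 'a where b: "b \<in> Basis" using nonempty_Basis by blast
  define T where "T = max \<rho> 0 + 1"
  have T: "T > 0" by (simp add: T_def)
  have "((\<lambda>t. u (t *\<^sub>R b)) has_real_derivative D u (t *\<^sub>R b) b) (at t)" for t
  proof -
    have "((\<lambda>t. t *\<^sub>R b) has_derivative (\<lambda>t. t *\<^sub>R b)) (at t)" by (auto intro!: derivative_eq_intros)
    from has_derivative_compose[OF this d]
    show ?thesis by (simp add: has_field_derivative_def linear_scale[OF l] times_eta)
  qed
  then obtain t where t: "0 < t" "t < T" "u (T *\<^sub>R b) - u (0 *\<^sub>R b) = (T - 0) * D u (t *\<^sub>R b) b"
    using MVT2[OF T, of "\<lambda>t. u (t *\<^sub>R b)" "\<lambda>t. D u (t *\<^sub>R b) b"] by blast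
  have "u (T *\<^sub>R b) = 0" using b T by (intro supported_withinD[OF supp]) (simp add: T_def)
  then have "D u (t *\<^sub>R b) b < 0" using t(3) T pos by (simp add: zero_less_mult_iff mult_less_0_iff)
      (metis T mult_nonneg_nonneg neg_less_0_iff_less not_le less_imp_le)
  then have neg: "D u (t *\<^sub>R b) (t *\<^sub>R b) < 0" using t(1) by (simp add: linear_scale[OF l] mult_pos_neg)
  have "integral\<^sup>L lborel f \<noteq> 0"
  proof
    assume "integral\<^sup>L lborel f = 0"
    then have "AE z in lborel. - f z = 0"
      using fi f_le by (subst integral_nonneg_eq_0_iff_AE[symmetric]) auto
    then have "AE z in lborel. z \<notin> {z. D u z z < 0}"
    proof eventually_elim
      case (elim z)
      show ?case
      proof
        assume "z \<in> {z. D u z z < 0}"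
        moreover from this have "z \<noteq> 0" using linear_0[OF l] by auto
        ultimately have "f z < 0" by (simp add: f_def divide_neg_pos)
        then show False using elim by simp
      qed
    qed
    moreover have "open {z. D u z z < 0}"
      unfolding Dsum[symmetric]
    proof (intro open_Collect_less continuous_on_const continuous_on_sum continuous_on_mult continuous_on_inner continuous_on_id)
      fix b :: 'a assume "b \<in> Basis"
      then have "Ck (Suc 0) (\<lambda>z. D u z b)" using u2 by (simp only: Ck.simps(2)[of "Suc 0"])
      from Ck_SucD[OF this] show "continuous_on UNIV (\<lambda>z. D u z b)" by simp
    qed
    ultimately show False using not_AE_notin_open neg by blast
  qed
  moreover have "integral\<^sup>L lborel f \<le> 0" using integral_mono[OF fi, of "\<lambda>_. 0"] f_le by simp
  ultimately show ?thesis using fI by simp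
qed

text \<open>
  The differential at the origin inherits collinearity with \<open>x\<close> from the fractional gradient itself, hence is a multiple of
  the identity; the sign of the factor is the sign of the trace.
\<close>

lemma frac_grad_linearization_at_0:
  fixes u :: "'a::euclidean_space \<Rightarrow> real"
  assumes s: "0 < s" "s < 1" and u: "Ck 2 u" and supp: "supported_within \<rho> u"
    and dec: "radially_decreasing u" and pos: "u 0 > 0"
  obtains \<kappa> where "\<kappa> > 0"
    "\<And>x. (\<lambda>n. real (Suc n) *\<^sub>R frac_grad s u ((1 / real (Suc n)) *\<^sub>R x)) \<longlonglongrightarrow> - (\<kappa> *\<^sub>R x)"
proof -
  have u2: "Ck (Suc (Suc 0)) u" using u by (simp only: numeral_2_eq_2)
  obtain M where bl: "bdd_lipschitz M u"
    by (rule bdd_lipschitz_of_Ck1[OF Ck_SucD[OF u2, folded One_nat_def] supp])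
  note rad = radially_decreasing_radial[OF dec]
  note lim = frac_grad_deriv_tendsto[OF s u supp rad]
  have orth: "frac_grad_deriv s u x \<bullet> w = 0" if "w \<bullet> x = 0" for x w
  proof -
    have "(real (Suc n) *\<^sub>R frac_grad s u ((1 / real (Suc n)) *\<^sub>R x)) \<bullet> w = 0" for n
    proof (cases "x = 0")
      case True
      then show ?thesis by (simp add: frac_grad_radial_0[OF rad s bl])
    next
      case False
      define y where "y = (1 / real (Suc n)) *\<^sub>R x"
      have "y \<noteq> 0" "y \<bullet> w = 0" using False that by (simp_all add: y_def inner_commute)
      from frac_grad_radial[OF rad s bl \<open>y \<noteq> 0\<close>] \<open>y \<bullet> w = 0\<close> have "frac_grad s u y \<bullet> w = 0"
        by (metis inner_scaleR_left mult_zero_right)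
      then show ?thesis by (simp add: y_def)
    qed
    moreover have "(\<lambda>n. (real (Suc n) *\<^sub>R frac_grad s u ((1 / real (Suc n)) *\<^sub>R x)) \<bullet> w) \<longlonglongrightarrow> frac_grad_deriv s u x \<bullet> w"
      by (intro tendsto_inner lim tendsto_const)
    ultimately show ?thesis by (simp add: LIMSEQ_const_iff)
  qed
  have "\<exists>k. (\<forall>x. frac_grad_deriv s u x = k *\<^sub>R x) \<and>
      (\<Sum>b\<in>Basis. frac_grad_deriv s u b \<bullet> b) = k * real DIM('a)"
    by (rule linear_collinear_imp_scaleR[OF frac_grad_deriv_linear[OF s u supp]]) (rule orth)
  then obtain k where k: "\<And>x. frac_grad_deriv s u x = k *\<^sub>R x"
      "(\<Sum>b\<in>Basis. frac_grad_deriv s u b \<bullet> b) = k * real DIM('a)"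
    by blast
  have "k * real DIM('a) < 0" using frac_grad_deriv_trace_neg[OF s u supp dec pos] k(2) by simp
  then have "k < 0" by (simp add: mult_less_0_iff)
  then show ?thesis using lim unfolding k(1) by (intro that[of "- k"]) auto
qed

section \<open>Rearrangement of a plateau carrying a bump\<close>

text \<open>
  A superlevel set contains with each point all points closer to the origin; being open, it contains with each point also
  points slightly farther away, so the supremum of the norms is not attained.
\<close>

lemma superlevel_set_is_ball:
  fixes v :: "'a::euclidean_space \<Rightarrow> real"
  assumes dec: "radially_decreasing v" and cont: "continuous_on UNIV v" and supp: "supported_within \<rho> v" and l: "l > 0"
  shows "\<exists>r. {y. v y > l} = ball 0 r"
proof (cases "{y. v y > l} = {}")
  case True
  then show ?thesis by (intro exI[of _ 0]) simp
next
  case False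
  define S where "S = {y. v y > l}"
  have open_S: "open S" unfolding S_def by (intro open_Collect_less continuous_on_const cont)
  define r where "r = Sup (norm ` S)"
  have "norm y \<le> \<rho>" if "y \<in> S" for y
    using that l supported_withinD[OF supp, of y] by (force simp: S_def)
  then have bdd: "bdd_above (norm ` S)" by (intro bdd_aboveI[of _ \<rho>]) auto
  have "S = ball 0 r"
  proof (intro equalityI subsetI)
    fix x assume x: "x \<in> S"
    then obtain e where e: "e > 0" "cball x e \<subseteq> S" using open_S open_contains_cball by blast
    obtain b :: 'a where b: "b \<in> Basis" using nonempty_Basis by blast
    \<comment> \<open>A unit vector pointing away from the origin.\<close>
    define w where "w = (if x = 0 then b else sgn x)"
    have "norm w = 1" using b by (simp add: w_def norm_sgn)
    then have "x + e *\<^sub>R w \<in> cball x e" using e by (simp add: dist_norm)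
    then have "norm (x + e *\<^sub>R w) \<le> r"
      unfolding r_def using e by (intro cSup_upper bdd) auto
    moreover have "norm (x + e *\<^sub>R w) = norm x + e"
    proof (cases "x = 0")
      case False
      then have "x + e *\<^sub>R w = (1 + e / norm x) *\<^sub>R x" by (simp add: w_def sgn_div_norm scaleR_add_left divide_inverse)
      then have "norm (x + e *\<^sub>R w) = (1 + e / norm x) * norm x" using e by simp
      then show ?thesis using False by (simp add: distrib_right)
    qed (use \<open>norm w = 1\<close> e in simp)
    ultimately show "x \<in> ball 0 r" using e by simp
  next
    fix x :: 'a assume "x \<in> ball 0 r"
    then have "norm x < Sup (norm ` S)" by (simp add: r_def)
    then obtain y where y: "y \<in> S" "norm x < norm y"
      using less_cSup_iff[OF _ bdd, of "norm x"] False by (auto simp: S_def)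
    have "v y \<le> v x" using y by (intro radially_decreasingD[OF dec]) simp
    then show "x \<in> S" using y by (simp add: S_def)
  qed
  then show ?thesis by (auto simp: S_def)
qed

lemma emeasure_ball_inj:
  assumes "emeasure lborel (ball (0::'a::euclidean_space) r) = emeasure lborel (ball (0::'a) t)"
  shows "ball (0::'a) r = ball 0 t"
proof -
  have pos: "emeasure lborel (ball (0::'a) t) > 0" if "t > 0" for t
    using that by (simp add: emeasure_ball ennreal_zero_less_mult_iff)
  consider "r \<le> 0" "t \<le> 0" | "r \<le> 0" "t > 0" | "r > 0" "t \<le> 0" | "r > 0" "t > 0" by linarith
  then show ?thesis
  proof cases
    case 1
    then show ?thesis by (simp add: ball_empty)
  next
    case 2
    then show ?thesis using assms pos[of t] by (simp add: ball_empty)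
  next
    case 3
    then show ?thesis using assms pos[of r] by (simp add: ball_empty)
  next
    case 4
    then have "unit_ball_vol (DIM('a)) * r ^ DIM('a) = unit_ball_vol (DIM('a)) * t ^ DIM('a)"
      using assms by (simp add: emeasure_ball ennreal_inj)
    then have "r ^ DIM('a) = t ^ DIM('a)"
      using unit_ball_vol_pos[of "real DIM('a)"] by (metis less_irrefl mult_cancel_left of_nat_0_le_iff)
    then have "r = t" using 4 by (intro power_eq_imp_eq_base[of r "DIM('a)" t]) auto
    then show ?thesis by simp
  qed
qed

lemma sym_ball_eq:
  fixes E :: "'a::euclidean_space set"
  assumes "emeasure lebesgue E = emeasure lborel (ball (0::'a) r)"
  shows "sym_ball E = ball 0 r"
  unfolding sym_ball_def
proof (rule the_equality)
  show "(\<exists>ra. ball 0 r = ball (0::'a) ra) \<and> emeasure lebesgue (ball (0::'a) r) = emeasure lebesgue E"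
    using assms by auto
  fix B :: "'a set"
  assume "(\<exists>r. B = ball 0 r) \<and> emeasure lebesgue B = emeasure lebesgue E"
  then obtain t where t: "B = ball 0 t" "emeasure lebesgue B = emeasure lebesgue E" by blast
  then have "emeasure lborel (ball (0::'a) t) = emeasure lborel (ball (0::'a) r)" using assms by simp
  then show "B = ball 0 r" unfolding t(1) by (rule emeasure_ball_inj)
qed

text \<open>
  A radially decreasing function equals its own rearrangement by the layer-cake formula, and the rearrangement depends only on the
  measures of the superlevel sets.
\<close>

lemma sym_decr_rearrangement_eqI:
  fixes u v :: "'a::euclidean_space \<Rightarrow> real"
  assumes dec: "radially_decreasing v" and cont: "continuous_on UNIV v" and supp: "supported_within \<rho> v"
    and nn: "\<And>x. 0 \<le> v x"
    and eq: "\<And>l. l > 0 \<Longrightarrow> emeasure lebesgue {y. u y > l} = emeasure lebesgue {y. v y > l}"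
  shows "sym_decr_rearrangement u = v"
proof
  fix x
  have sb: "sym_ball {y. u y > l} = {y. v y > l}" if l: "l > 0" for l
  proof -
    obtain r where r: "{y. v y > l} = ball 0 r" using superlevel_set_is_ball[OF dec cont supp l] by blast
    then have "sym_ball {y. u y > l} = ball 0 r" using eq[OF l] by (intro sym_ball_eq) simp
    then show ?thesis by (simp only: r)
  qed
  have "sym_decr_rearrangement u x = (\<integral>l. indicator {0<..<v x} l \<partial>lebesgue)"
    unfolding sym_decr_rearrangement_def set_lebesgue_integral_def
    by (intro Bochner_Integration.integral_cong refl) (auto simp: indicator_def sb)
  also have "\<dots> = v x" using nn[of x] by simp
  finally show "sym_decr_rearrangement u x = v x" .
qed

text \<open>
  Below the height of the plateau a superlevel set does not see the bump, since it contains the whole plateau.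
  At or above that height it consists only of points under the bump, and moves rigidly with it.
\<close>

lemma emeasure_superlevel_translate_bump:
  fixes F g :: "'a::euclidean_space \<Rightarrow> real"
  assumes F: "\<And>x. F x \<le> F 0" "\<And>x. norm x \<le> P \<Longrightarrow> F x = F 0"
    and g: "continuous_on UNIV g" "\<And>x. 0 \<le> g x" "supported_within Q g" and PQ: "Q + norm a \<le> P"
  shows "emeasure lebesgue {y. F y + g (y - a) > l} = emeasure lebesgue {y. F y + g y > l}"
proof (cases "l < F 0")
  case True
  have "F y + g (y - a) > l \<longleftrightarrow> F y + g y > l" for y
  proof (cases "norm y \<le> P")
    case True
    then show ?thesis using F(2)[of y] g(2)[of y] g(2)[of "y - a"] \<open>l < F 0\<close> by simp
  next
    case False
    have "norm y \<le> norm (y - a) + norm a" using norm_triangle_ineq[of "y - a" a] by simp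
    then have "g y = 0" "g (y - a) = 0"
      using False PQ norm_ge_zero[of a] by (auto intro!: supported_withinD[OF g(3)] simp del: norm_ge_zero)
    then show ?thesis by simp
  qed
  then show ?thesis by simp
next
  case False
  have v: "F y + g (y - b) > l \<longleftrightarrow> g (y - b) > l - F 0" if "Q + norm b \<le> P" for y b
  proof (cases "g (y - b) = 0")
    case True
    then show ?thesis using F(1)[of y] False by simp
  next
    case nz: False
    then have "norm (y - b) \<le> Q" using supported_withinD[OF g(3), of "y - b"] by force
    moreover have "norm y \<le> norm (y - b) + norm b" using norm_triangle_ineq[of "y - b" b] by simp
    ultimately have "F y = F 0" using that by (intro F(2)) simp
    then show ?thesis by (simp add: algebra_simps)
  qed
  define S where "S = {y. g y > l - F 0}"
  have open_S: "open S" unfolding S_def by (intro open_Collect_less continuous_on_const g)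
  have "{y. F y + g (y - a) > l} = (\<lambda>y. y + - a) -` S" using v[OF PQ] by (auto simp: S_def)
  moreover have "{y. F y + g y > l} = S"
    using v[of 0] PQ norm_ge_zero[of a] by (auto simp: S_def simp del: norm_ge_zero)
  moreover have "emeasure lborel ((\<lambda>y. y + - a) -` S) = emeasure lborel S"
    using emeasure_distr[of "\<lambda>y. y + - a" lborel borel S, unfolded distr_lborel_translate] open_S by simp
  moreover have "open ((\<lambda>y. y + - a) -` S)" by (intro open_vimage open_S continuous_intros)
  ultimately show ?thesis using open_S by simp
qed

lemma Lp_norm_eq:
  fixes F :: "'a::euclidean_space \<Rightarrow> 'b::{real_normed_vector, second_countable_topology}"
  assumes "integrable lborel (\<lambda>x. norm (F x) powr p)"
  shows "Lp_norm p F = ennreal ((\<integral>x. norm (F x) powr p \<partial>lborel) powr (1 / p))"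
proof -
  have "(\<integral>\<^sup>+x. ennreal (norm (F x) powr p) \<partial>lebesgue) = ennreal (\<integral>x. norm (F x) powr p \<partial>lborel)"
    unfolding nn_integral_completion using assms by (intro nn_integral_eq_integral) auto
  then show ?thesis by (simp add: Lp_norm_def Let_def integral_nonneg_AE)
qed

lemma smooth_compact_supportI:
  fixes u :: "'a::euclidean_space \<Rightarrow> real"
  assumes "\<And>k. Ck k u" "supported_within \<rho> u"
  shows "smooth_compact_support u"
proof -
  have "{x. u x \<noteq> 0} \<subseteq> cball 0 \<rho>"
  proof
    fix x assume "x \<in> {x. u x \<noteq> 0}"
    then show "x \<in> cball 0 \<rho>" using supported_withinD[OF assms(2), of x] by (cases "norm x \<le> \<rho>") auto
  qed
  then have "bounded {x. u x \<noteq> 0}" using bounded_subset bounded_cball by blast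
  then show ?thesis using assms(1) by (simp add: smooth_compact_support_def compact_closure)
qed

section \<open>The limiting interaction energy\<close>

lemma duality_map_continuous:
  fixes X :: "nat \<Rightarrow> 'a::real_inner"
  assumes q: "0 < q" "q < 1" and X: "X \<longlonglongrightarrow> x"
  shows "(\<lambda>n. duality_map q (X n)) \<longlonglongrightarrow> duality_map q x"
proof -
  have "(\<lambda>n. 4 * norm (X n - x) powr q) \<longlonglongrightarrow> 4 * norm (x - x) powr q"
    using q by (intro tendsto_intros X) auto
  then have lim: "(\<lambda>n. 4 * norm (X n - x) powr q) \<longlonglongrightarrow> 0" by simp
  have "(\<lambda>n. duality_map q (X n) - duality_map q x) \<longlonglongrightarrow> 0"
    by (rule Lim_null_comparison[OF _ lim]) (simp add: duality_map_holder[OF q])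
  then show ?thesis by (rule LIM_zero_cancel)
qed

lemma duality_map_measurable [measurable]:
  "duality_map q \<in> borel_measurable (borel :: 'a::euclidean_space measure)"
  unfolding duality_map_def[abs_def] by measurable

definition second_diff :: "('a::real_vector \<Rightarrow> 'b::real_vector) \<Rightarrow> 'a \<Rightarrow> 'a \<Rightarrow> 'b" where
  "second_diff V a x = V (x + a) + V (x - a) - 2 *\<^sub>R V x"

text \<open>
  The bound is uniform in \<open>x\<close> and depends on the field only through its Lipschitz constant, so it serves as a majorant
  for a whole family of fields; the decay at infinity comes from the other factor of the pairing.
\<close>

lemma second_diff_duality_map_bound:
  fixes F :: "'a::euclidean_space \<Rightarrow> 'a"
  assumes q: "0 < q" "q < 1" and F: "\<And>x y. norm (F x - F y) \<le> L * norm (x - y)"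
  shows "norm (second_diff (\<lambda>x. duality_map q (F x)) a x) \<le> 8 * (L * norm a) powr q"
proof -
  have le: "norm (duality_map q (F y) - duality_map q (F x)) \<le> 4 * (L * norm a) powr q" if "norm (y - x) = norm a" for y
  proof -
    have "norm (F y - F x) powr q \<le> (L * norm a) powr q"
      using F[of y x] that q by (intro powr_mono2) auto
    then show ?thesis using duality_map_holder[OF q, of "F y" "F x"] by linarith
  qed
  have "second_diff (\<lambda>x. duality_map q (F x)) a x
      = (duality_map q (F (x + a)) - duality_map q (F x)) + (duality_map q (F (x - a)) - duality_map q (F x))"
    by (simp add: second_diff_def scaleR_2)
  also have "norm \<dots> \<le> 4 * (L * norm a) powr q + 4 * (L * norm a) powr q"
    by (intro norm_triangle_mono le) simp_all
  finally show ?thesis by simp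
qed

lemma frac_grad_integrable_powr:
  fixes u :: "'a::euclidean_space \<Rightarrow> real"
  assumes s: "0 < s" "s < 1" and u: "bdd_lipschitz M u" and supp: "supported_within \<rho> u" and p: "p \<ge> 1"
  shows "integrable lborel (\<lambda>x. norm (frac_grad s u x) powr p)" "integrable lborel (frac_grad s u)"
proof -
  have m: "frac_grad s u \<in> borel_measurable borel" by (rule frac_grad_measurable[OF bdd_lipschitz_measurable[OF u]])
  obtain C where C: "C \<ge> 0" "\<And>x. norm (frac_grad s u x) \<le> C * (1 + norm x) powr (- real DIM('a) - s)"
    by (rule frac_grad_decay[OF s u supp]) blast
  show "integrable lborel (\<lambda>x. norm (frac_grad s u x) powr p)"
    by (rule decay_integrable_powr[OF m s(1) p C])
  have "integrable lborel (\<lambda>x. norm (frac_grad s u x) powr 1)"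
    by (rule decay_integrable_powr[OF m s(1) _ C]) simp
  then have "integrable lborel (\<lambda>x. norm (frac_grad s u x))" by simp
  then show "integrable lborel (frac_grad s u)" using m by (subst (asm) integrable_norm_iff) simp_all
qed

text \<open>
  Both factors have a known sign against \<open>x\<close>: \<open>G(x)\<close> is a nonpositive multiple of \<open>x\<close>, and the second difference has negative inner
  product with \<open>x\<close> except at \<open>0\<close> and \<open>\<plusminus> a\<close>. Strictness comes from the exterior of the support of \<open>g\<close>, where \<open>G\<close> does
  not vanish.
\<close>

lemma second_diff_pairing_pos:
  fixes g :: "'a::euclidean_space \<Rightarrow> real"
  assumes q: "0 < q" "q < 1" and s: "0 < s" "s < 1" and g: "bdd_lipschitz M g" and supp: "supported_within \<rho> g"
    and dec: "radially_decreasing g" and nn: "\<And>x. 0 \<le> g x" and pos: "g 0 > 0" and a: "a \<noteq> 0"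
  shows "0 < (\<integral>x. second_diff (duality_map q) a x \<bullet> frac_grad s g x \<partial>lborel)"
proof -
  let ?G = "frac_grad s g" and ?A = "second_diff (duality_map q) a"
  have Gi: "integrable lborel ?G" by (rule frac_grad_integrable_powr(2)[OF s g supp, of 1]) simp
  have [measurable]: "?G \<in> borel_measurable borel" by (rule frac_grad_measurable[OF bdd_lipschitz_measurable[OF g]])
  have [measurable]: "?A \<in> borel_measurable borel" unfolding second_diff_def[abs_def] by measurable
  have Abd: "norm (?A x) \<le> 8 * (1 * norm a) powr q" for x
    using second_diff_duality_map_bound[OF q, of "\<lambda>x. x" 1 a x] by simp
  have i: "integrable lborel (\<lambda>x. ?A x \<bullet> ?G x)"
  proof (rule Bochner_Integration.integrable_bound)
    show "integrable lborel (\<lambda>x. (8 * (1 * norm a) powr q) * norm (?G x))"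
      using Gi by (intro integrable_mult_right integrable_norm)
    show "AE x in lborel. norm (?A x \<bullet> ?G x) \<le> norm ((8 * (1 * norm a) powr q) * norm (?G x))"
    proof (rule AE_I2)
      fix x
      have "norm (?A x \<bullet> ?G x) \<le> norm (?A x) * norm (?G x)" using Cauchy_Schwarz_ineq2 by simp
      also have "\<dots> \<le> (8 * (1 * norm a) powr q) * norm (?G x)" by (intro mult_right_mono Abd) simp
      finally show "norm (?A x \<bullet> ?G x) \<le> norm ((8 * (1 * norm a) powr q) * norm (?G x))" by simp
    qed
  qed measurable
  have Ax: "?A x \<bullet> x < 0" if "x \<noteq> 0" "x \<noteq> a" "x \<noteq> - a" for x
  proof -
    have "x + a \<noteq> 0" "x - a \<noteq> 0" using that by (auto simp: eq_neg_iff_add_eq_0)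
    from duality_map_midpoint[OF q \<open>x \<noteq> 0\<close> a this]
    show ?thesis by (simp add: second_diff_def inner_diff_left)
  qed
  have eq: "?A x \<bullet> ?G x = (?G x \<bullet> x) / (x \<bullet> x) * (?A x \<bullet> x)" if "x \<noteq> 0" for x
    by (subst frac_grad_radial[OF radially_decreasing_radial[OF dec] s g that]) simp
  have G0: "?G 0 = 0" by (rule frac_grad_radial_0[OF radially_decreasing_radial[OF dec] s g])
  have nonneg: "0 \<le> ?A x \<bullet> ?G x" if "x \<noteq> a" "x \<noteq> - a" for x
  proof (cases "x = 0")
    case False
    have "(?G x \<bullet> x) / (x \<bullet> x) \<le> 0"
      using frac_grad_inward[OF dec s g, of x] by (simp add: divide_nonpos_nonneg)
    moreover have "?A x \<bullet> x \<le> 0" using Ax[OF False that] by (rule less_imp_le)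
    ultimately show ?thesis unfolding eq[OF False] by (rule mult_nonpos_nonpos)
  qed (simp add: G0)
  define r where "r = max (max \<rho> 0) (norm a)"
  have gt: "0 < ?A x \<bullet> ?G x" if x: "norm x > r" for x
  proof -
    have x0: "x \<noteq> 0" "x \<noteq> a" "x \<noteq> - a" using x by (auto simp: r_def)
    have "?G x \<bullet> x < 0" using x by (intro frac_grad_inward_strict[OF nn pos supp s g]) (simp add: r_def)
    then have "(?G x \<bullet> x) / (x \<bullet> x) < 0" using x0 by (simp add: divide_neg_pos)
    then show ?thesis unfolding eq[OF x0(1)] using Ax[OF x0] by (rule mult_neg_neg)
  qed
  have nn_AE: "AE x in lborel. 0 \<le> ?A x \<bullet> ?G x"
    using AE_lborel_singleton[of a] AE_lborel_singleton[of "- a"] by eventually_elim (rule nonneg)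
  have "(\<integral>x. ?A x \<bullet> ?G x \<partial>lborel) \<noteq> 0"
  proof
    assume "(\<integral>x. ?A x \<bullet> ?G x \<partial>lborel) = 0"
    then have "AE x in lborel. ?A x \<bullet> ?G x = 0"
      using integral_nonneg_eq_0_iff_AE[OF i nn_AE] by simp
    then have "AE x in lborel. x \<notin> {x::'a. norm x > r}"
      by eventually_elim (use gt in fastforce)
    moreover have "open {x::'a. norm x > r}" by (intro open_Collect_less continuous_intros)
    moreover obtain b :: 'a where "b \<in> Basis" using nonempty_Basis by blast
    moreover have "r \<ge> 0" by (simp add: r_def le_max_iff_disj)
    ultimately have "norm ((r + 1) *\<^sub>R b) > r" by simp
    then have "(r + 1) *\<^sub>R b \<in> {x. norm x > r}" by simp
    with not_AE_notin_open[OF \<open>open {x::'a. norm x > r}\<close>] \<open>AE x in lborel. x \<notin> {x::'a. norm x > r}\<close>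
    show False by blast
  qed
  moreover have "0 \<le> (\<integral>x. ?A x \<bullet> ?G x \<partial>lborel)" by (rule integral_nonneg_AE[OF nn_AE])
  ultimately show "0 < (\<integral>x. ?A x \<bullet> ?G x \<partial>lborel)" by simp
qed

text \<open>
  The power of \<open>R\<close> in front is chosen such that the fractional gradient \<open>F\<close> of \<open>f\<close> becomes \<open>R F(x / R)\<close>: the Lipschitz
  constant stays the same, and as \<open>R\<close> grows the field converges to the differential of \<open>F\<close> at the
  origin.
\<close>

definition rescale :: "real \<Rightarrow> real \<Rightarrow> ('a::real_vector \<Rightarrow> real) \<Rightarrow> 'a \<Rightarrow> real" where
  "rescale s R f x = R powr (1 + s) * f ((1 / R) *\<^sub>R x)"

lemma frac_grad_rescale:
  fixes f :: "'a::euclidean_space \<Rightarrow> real"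
  assumes R: "R > 0" and s: "0 < s" "s < 1" and f: "bdd_lipschitz M f"
  shows "frac_grad s (rescale s R f) x = R *\<^sub>R frac_grad s f ((1 / R) *\<^sub>R x)"
proof -
  have "frac_grad s (rescale s R f) x = R powr (1 + s) *\<^sub>R frac_grad s (\<lambda>x. f ((1 / R) *\<^sub>R x)) x"
    unfolding frac_grad_def rescale_def
    by (subst integral_scaleR_right[symmetric]) (simp add: right_diff_distrib[symmetric])
  also have "\<dots> = (R powr (1 + s) * R powr - s) *\<^sub>R frac_grad s f ((1 / R) *\<^sub>R x)"
    by (simp only: frac_grad_dilate[OF R bdd_lipschitz_measurable[OF f]] scaleR_scaleR)
  also have "R powr (1 + s) * R powr - s = R" using R by (simp flip: powr_add)
  finally show ?thesis .
qed

text \<open>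
  Dominated convergence. The rescaled gradients converge pointwise to \<open>- k x\<close>, the second differences
  are bounded uniformly in \<open>n\<close> and \<open>x\<close> since all rescaled gradients share one Lipschitz constant, and \<open>G\<close> is integrable.
\<close>

lemma second_diff_pairing_tendsto:
  fixes f g :: "'a::euclidean_space \<Rightarrow> real"
  assumes q: "0 < q" "q < 1" and s: "0 < s" "s < 1"
    and f: "Ck 2 f" "supported_within \<rho> f" "radially_decreasing f" "f 0 > 0"
    and g: "bdd_lipschitz M g" "supported_within \<sigma> g"
  obtains \<kappa> where "\<kappa> > 0"
    "(\<lambda>n. \<integral>x. second_diff (\<lambda>x. duality_map q (frac_grad s (rescale s (real (Suc n)) f) x)) a x \<bullet> frac_grad s g x \<partial>lborel)
      \<longlonglongrightarrow> - (\<kappa> * (\<integral>x. second_diff (duality_map q) a x \<bullet> frac_grad s g x \<partial>lborel))"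
proof -
  let ?G = "frac_grad s g"
  have f2: "Ck (Suc (Suc 0)) f" using f(1) by (simp only: numeral_2_eq_2)
  obtain M' where fl: "bdd_lipschitz M' f"
    by (rule bdd_lipschitz_of_Ck1[OF Ck_SucD[OF f2, folded One_nat_def] f(2)])
  obtain L where L: "L \<ge> 0" "\<And>x y. norm (frac_grad s f x - frac_grad s f y) \<le> L * norm (x - y)"
    by (rule frac_grad_lipschitz[OF s f(1,2)]) blast
  obtain k where k: "k > 0"
    "\<And>x. (\<lambda>n. real (Suc n) *\<^sub>R frac_grad s f ((1 / real (Suc n)) *\<^sub>R x)) \<longlonglongrightarrow> - (k *\<^sub>R x)"
    by (rule frac_grad_linearization_at_0[OF s f]) blast
  define F where "F n = frac_grad s (rescale s (real (Suc n)) f)" for n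
  have F: "F n x = real (Suc n) *\<^sub>R frac_grad s f ((1 / real (Suc n)) *\<^sub>R x)" for n x
    unfolding F_def by (rule frac_grad_rescale[OF _ s fl]) simp
  have [measurable]: "frac_grad s f \<in> borel_measurable borel" "?G \<in> borel_measurable borel"
    by (rule frac_grad_measurable[OF bdd_lipschitz_measurable[OF fl]],
        rule frac_grad_measurable[OF bdd_lipschitz_measurable[OF g(1)]])
  have [measurable]: "F n \<in> borel_measurable borel" for n
    unfolding F[abs_def] by measurable
  have FL: "norm (F n x - F n y) \<le> L * norm (x - y)" for n x y
  proof -
    have "norm (F n x - F n y) = real (Suc n) * norm (frac_grad s f ((1 / real (Suc n)) *\<^sub>R x) - frac_grad s f ((1 / real (Suc n)) *\<^sub>R y))"
      by (simp only: F scaleR_diff_right[symmetric] norm_scaleR abs_of_nat)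
    also have "\<dots> \<le> real (Suc n) * (L * norm ((1 / real (Suc n)) *\<^sub>R x - (1 / real (Suc n)) *\<^sub>R y))"
      by (intro mult_left_mono L) simp
    also have "\<dots> = L * norm (x - y)"
      by (simp only: scaleR_diff_right[symmetric] norm_scaleR) simp
    finally show ?thesis .
  qed
  have Flim: "(\<lambda>n. duality_map q (F n x)) \<longlonglongrightarrow> - (k powr q *\<^sub>R duality_map q x)" for x
  proof -
    have "(\<lambda>n. duality_map q (F n x)) \<longlonglongrightarrow> duality_map q (- (k *\<^sub>R x))"
      unfolding F by (intro duality_map_continuous q k(2))
    then show ?thesis using k(1) by (simp add: duality_map_minus duality_map_scaleR)
  qed
  have Gi: "integrable lborel ?G" by (rule frac_grad_integrable_powr(2)[OF s g, of 1]) simp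
  have "(\<lambda>n. \<integral>x. second_diff (\<lambda>x. duality_map q (F n x)) a x \<bullet> ?G x \<partial>lborel)
      \<longlonglongrightarrow> (\<integral>x. - (k powr q * (second_diff (duality_map q) a x \<bullet> ?G x)) \<partial>lborel)"
  proof (rule integral_dominated_convergence)
    show "integrable lborel (\<lambda>x. (8 * (L * norm a) powr q) * norm (?G x))"
      using Gi by (intro integrable_mult_right integrable_norm)
    show "AE x in lborel. norm (second_diff (\<lambda>x. duality_map q (F n x)) a x \<bullet> ?G x) \<le> (8 * (L * norm a) powr q) * norm (?G x)" for n
    proof (rule AE_I2)
      fix x
      have "norm (second_diff (\<lambda>x. duality_map q (F n x)) a x \<bullet> ?G x)
          \<le> norm (second_diff (\<lambda>x. duality_map q (F n x)) a x) * norm (?G x)"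
        using Cauchy_Schwarz_ineq2 by simp
      also have "\<dots> \<le> (8 * (L * norm a) powr q) * norm (?G x)"
        by (intro mult_right_mono second_diff_duality_map_bound[OF q FL]) simp
      finally show "norm (second_diff (\<lambda>x. duality_map q (F n x)) a x \<bullet> ?G x) \<le> (8 * (L * norm a) powr q) * norm (?G x)" .
    qed
    show "AE x in lborel. (\<lambda>n. second_diff (\<lambda>x. duality_map q (F n x)) a x \<bullet> ?G x)
        \<longlonglongrightarrow> - (k powr q * (second_diff (duality_map q) a x \<bullet> ?G x))"
    proof (rule AE_I2)
      fix x
      have "(\<lambda>n. second_diff (\<lambda>x. duality_map q (F n x)) a x \<bullet> ?G x)
        \<longlonglongrightarrow> (- (k powr q *\<^sub>R duality_map q (x + a)) + - (k powr q *\<^sub>R duality_map q (x - a))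
          - 2 *\<^sub>R (- (k powr q *\<^sub>R duality_map q x))) \<bullet> ?G x"
        unfolding second_diff_def by (intro tendsto_intros Flim)
      also have "(- (k powr q *\<^sub>R duality_map q (x + a)) + - (k powr q *\<^sub>R duality_map q (x - a))
          - 2 *\<^sub>R (- (k powr q *\<^sub>R duality_map q x))) \<bullet> ?G x = - (k powr q * (second_diff (duality_map q) a x \<bullet> ?G x))"
        by (simp add: second_diff_def inner_simps algebra_simps)
      finally show "(\<lambda>n. second_diff (\<lambda>x. duality_map q (F n x)) a x \<bullet> ?G x)
        \<longlonglongrightarrow> - (k powr q * (second_diff (duality_map q) a x \<bullet> ?G x))" .
    qed
  qed (unfold second_diff_def, measurable)
  then show ?thesis using k(1) unfolding F_def by (intro that[of "k powr q"]) simp_all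
qed

section \<open>Comparing the two energies\<close>

text \<open>
  First-order expansion of the energy at \<open>F\<close>: the lower bound is convexity, the upper bound has an error that is
  superlinear in \<open>G\<close> since \<open>p > 1\<close>.
\<close>

lemma energy_bounds:
  fixes F G :: "'a::euclidean_space \<Rightarrow> 'a"
  assumes p: "1 < p" "p < 2" and [measurable]: "F \<in> borel_measurable borel" "G \<in> borel_measurable borel"
    and F: "integrable lborel (\<lambda>x. norm (F x) powr p)" and G: "integrable lborel (\<lambda>x. norm (G x) powr p)"
    and FG: "integrable lborel (\<lambda>x. duality_map (p - 1) (F x) \<bullet> G x)"
  shows "(\<integral>x. norm (F x) powr p \<partial>lborel) + p * (\<integral>x. duality_map (p - 1) (F x) \<bullet> G x \<partial>lborel)
      \<le> (\<integral>x. norm (F x + G x) powr p \<partial>lborel)"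
    and "(\<integral>x. norm (F x + G x) powr p \<partial>lborel)
      \<le> (\<integral>x. norm (F x) powr p \<partial>lborel) + p * (\<integral>x. duality_map (p - 1) (F x) \<bullet> G x \<partial>lborel)
        + 4 * p * (\<integral>x. norm (G x) powr p \<partial>lborel)"
proof -
  let ?lo = "\<lambda>x. norm (F x) powr p + p * (duality_map (p - 1) (F x) \<bullet> G x)"
  let ?up = "\<lambda>x. ?lo x + 4 * p * norm (G x) powr p"
  have lo: "integrable lborel ?lo"
    by (intro Bochner_Integration.integrable_add integrable_mult_right F FG)
  have up: "integrable lborel ?up"
    by (intro Bochner_Integration.integrable_add integrable_mult_right lo G)
  have le: "norm (F x + G x) powr p \<le> ?up x" for x
    by (rule norm_powr_add_le[OF p])
  have i: "integrable lborel (\<lambda>x. norm (F x + G x) powr p)"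
  proof (rule Bochner_Integration.integrable_bound[OF up])
    show "AE x in lborel. norm (norm (F x + G x) powr p) \<le> norm (?up x)"
    proof (rule AE_I2)
      fix x
      show "norm (norm (F x + G x) powr p) \<le> norm (?up x)"
        using le[of x] order_trans[OF le[of x] abs_ge_self] by (simp only: real_norm_def abs_of_nonneg powr_ge_zero)
    qed
  qed measurable
  have "(\<integral>x. ?lo x \<partial>lborel) \<le> (\<integral>x. norm (F x + G x) powr p \<partial>lborel)"
    by (intro integral_mono lo i norm_powr_add_ge p)
  then show "(\<integral>x. norm (F x) powr p \<partial>lborel) + p * (\<integral>x. duality_map (p - 1) (F x) \<bullet> G x \<partial>lborel)
      \<le> (\<integral>x. norm (F x + G x) powr p \<partial>lborel)"
    by (simp add: F FG)
  have "(\<integral>x. norm (F x + G x) powr p \<partial>lborel) \<le> (\<integral>x. ?up x \<partial>lborel)"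
    by (intro integral_mono up i le)
  also have "\<dots> = (\<integral>x. ?lo x \<partial>lborel) + 4 * p * (\<integral>x. norm (G x) powr p \<partial>lborel)"
    using lo G by (subst Bochner_Integration.integral_add) simp_all
  also have "(\<integral>x. ?lo x \<partial>lborel) = (\<integral>x. norm (F x) powr p \<partial>lborel) + p * (\<integral>x. duality_map (p - 1) (F x) \<bullet> G x \<partial>lborel)"
    using F FG by (subst Bochner_Integration.integral_add) simp_all
  finally show "(\<integral>x. norm (F x + G x) powr p \<partial>lborel)
      \<le> (\<integral>x. norm (F x) powr p \<partial>lborel) + p * (\<integral>x. duality_map (p - 1) (F x) \<bullet> G x \<partial>lborel)
        + 4 * p * (\<integral>x. norm (G x) powr p \<partial>lborel)" .
qed

text \<open>
  With \<open>i b\<close> the first-order coefficient for the bump at position \<open>b\<close>, the hypothesis says that \<open>i 0\<close>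
  exceeds the mean of \<open>i a\<close> and \<open>i (- a)\<close>. The lower energy bound at the centre and the upper bounds at \<open>\<plusminus> a\<close>
  then give \<open>E a + E (- a) < 2 E 0\<close> for small \<open>\<epsilon>\<close>, so at least one of the two positions has smaller energy than
  the centre.
\<close>

lemma translate_lowers_energy:
  fixes F G :: "'a::euclidean_space \<Rightarrow> 'a"
  assumes p: "1 < p" "p < 2" and [measurable]: "F \<in> borel_measurable borel" "G \<in> borel_measurable borel"
    and F: "integrable lborel (\<lambda>x. norm (F x) powr p)" and G: "integrable lborel (\<lambda>x. norm (G x) powr p)"
    and B: "\<And>x. norm (F x) \<le> B" and Gi: "integrable lborel G"
    and J: "(\<integral>x. second_diff (\<lambda>x. duality_map (p - 1) (F x)) a x \<bullet> G x \<partial>lborel) < 0"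
  shows "\<exists>\<epsilon>>0. \<exists>b\<in>{a, - a}. (\<integral>x. norm (F x + \<epsilon> *\<^sub>R G (x - b)) powr p \<partial>lborel)
    < (\<integral>x. norm (F x + \<epsilon> *\<^sub>R G x) powr p \<partial>lborel)"
proof -
  define W where "W = (\<lambda>x. duality_map (p - 1) (F x))"
  have [measurable]: "W \<in> borel_measurable borel" unfolding W_def by measurable
  have Wbd: "norm (W x) \<le> B powr (p - 1)" for x
    unfolding W_def norm_duality_map using B[of x] p by (intro powr_mono2) auto
  have WG: "integrable lborel (\<lambda>x. W (x + b) \<bullet> G x)" for b
  proof (rule Bochner_Integration.integrable_bound)
    show "integrable lborel (\<lambda>x. B powr (p - 1) * norm (G x))"
      using Gi by (intro integrable_mult_right integrable_norm)
    show "AE x in lborel. norm (W (x + b) \<bullet> G x) \<le> norm (B powr (p - 1) * norm (G x))"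
    proof (rule AE_I2)
      fix x
      have "norm (W (x + b) \<bullet> G x) \<le> norm (W (x + b)) * norm (G x)" using Cauchy_Schwarz_ineq2 by simp
      also have "\<dots> \<le> B powr (p - 1) * norm (G x)" by (intro mult_right_mono Wbd) simp
      finally show "norm (W (x + b) \<bullet> G x) \<le> norm (B powr (p - 1) * norm (G x))" by simp
    qed
  qed measurable
  define i where "i b = (\<integral>x. W (x + b) \<bullet> G x \<partial>lborel)" for b
  have WG': "integrable lborel (\<lambda>x. W x \<bullet> G (x - b))" for b
    using lborel_integrable_translate[OF WG[of b], of "- b"] by simp
  have i': "(\<integral>x. W x \<bullet> G (x - b) \<partial>lborel) = i b" for b
    unfolding i_def using lborel_integral_translate[of "\<lambda>x. W (x + b) \<bullet> G x" "- b"] by simp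
  have "(\<integral>x. second_diff W a x \<bullet> G x \<partial>lborel) = (\<integral>x. W (x + a) \<bullet> G x + W (x + - a) \<bullet> G x - 2 * (W (x + 0) \<bullet> G x) \<partial>lborel)"
    by (simp add: second_diff_def inner_add_left inner_diff_left)
  also have "\<dots> = i a + i (- a) - 2 * i 0"
    unfolding i_def using WG[of a] WG[of "- a"] WG[of 0]
    by (simp only: Bochner_Integration.integral_diff Bochner_Integration.integral_add
        Bochner_Integration.integrable_add integrable_mult_right integral_mult_right_zero)
  finally have J: "i a + i (- a) - 2 * i 0 < 0" using J by (simp add: W_def)
  define \<Gamma> where "\<Gamma> = (\<integral>x. norm (G x) powr p \<partial>lborel)"
  have \<Gamma>: "\<Gamma> \<ge> 0" by (simp add: \<Gamma>_def)
  define j where "j = 2 * i 0 - i a - i (- a)"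
  have j: "j > 0" using J by (simp add: j_def)
  \<comment> \<open>The gain is \<open>p \<epsilon> j\<close> and the total error \<open>8 p \<epsilon>\<^sup>p \<Gamma>\<close>, so \<open>8 \<Gamma> \<epsilon>\<^bsup>p-1\<^esup> < j\<close> is what is needed.\<close>
  define \<epsilon> where "\<epsilon> = (j / (8 * \<Gamma> + 1)) powr (1 / (p - 1))"
  have \<epsilon>: "\<epsilon> > 0" using j \<Gamma> by (simp add: \<epsilon>_def)
  have \<epsilon>p: "\<epsilon> powr (p - 1) = j / (8 * \<Gamma> + 1)" using j \<Gamma> p by (simp add: \<epsilon>_def powr_powr)
  define E where "E b = (\<integral>x. norm (F x + \<epsilon> *\<^sub>R G (x - b)) powr p \<partial>lborel)" for b
  define E0 where "E0 = (\<integral>x. norm (F x) powr p \<partial>lborel)"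
  have norm_eG: "norm (\<epsilon> *\<^sub>R G y) powr p = \<epsilon> powr p * norm (G y) powr p" for y
    using \<epsilon> by (simp add: powr_mult)
  have iG: "integrable lborel (\<lambda>x. norm (\<epsilon> *\<^sub>R G (x - b)) powr p)" for b
    unfolding norm_eG using lborel_integrable_translate[OF G, of "- b"] by (simp add: integrable_mult_right)
  have \<Gamma>': "(\<integral>x. norm (\<epsilon> *\<^sub>R G (x - b)) powr p \<partial>lborel) = \<epsilon> powr p * \<Gamma>" for b
    unfolding norm_eG \<Gamma>_def using lborel_integral_translate[of "\<lambda>x. norm (G x) powr p" "- b"] by simp
  have iW: "integrable lborel (\<lambda>x. duality_map (p - 1) (F x) \<bullet> (\<epsilon> *\<^sub>R G (x - b)))" for b
    using WG'[of b] by (simp add: W_def)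
  have IW: "(\<integral>x. duality_map (p - 1) (F x) \<bullet> (\<epsilon> *\<^sub>R G (x - b)) \<partial>lborel) = \<epsilon> * i b" for b
    using i'[of b] by (simp add: W_def)
  have lower: "E0 + p * (\<epsilon> * i b) \<le> E b" and upper: "E b \<le> E0 + p * (\<epsilon> * i b) + 4 * p * (\<epsilon> powr p * \<Gamma>)" for b
    using energy_bounds[OF p _ _ F iG iW, of b] unfolding IW \<Gamma>' E_def[symmetric] E0_def[symmetric] by simp_all
  have "E a + E (- a) < 2 * E 0"
  proof -
    have "2 * E 0 - (E a + E (- a)) \<ge> p * \<epsilon> * j - 8 * p * (\<epsilon> powr p * \<Gamma>)"
      using lower[of 0] upper[of a] upper[of "- a"] by (simp add: j_def algebra_simps)
    moreover have "0 < p * \<epsilon> * j - 8 * p * (\<epsilon> powr p * \<Gamma>)"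
    proof -
      have "\<epsilon> powr p = \<epsilon> * \<epsilon> powr (p - 1)" using \<epsilon> by (simp add: powr_diff)
      then have "p * \<epsilon> * j - 8 * p * (\<epsilon> powr p * \<Gamma>) = p * \<epsilon> * (j - 8 * \<Gamma> * (j / (8 * \<Gamma> + 1)))"
        unfolding \<epsilon>p by (simp add: algebra_simps)
      also have "j - 8 * \<Gamma> * (j / (8 * \<Gamma> + 1)) = j / (8 * \<Gamma> + 1)" using \<Gamma> by (simp add: field_simps)
      finally show ?thesis using p \<epsilon> j \<Gamma> by simp
    qed
    ultimately show ?thesis by linarith
  qed
  then have "E a < E 0 \<or> E (- a) < E 0" by linarith
  then show ?thesis using \<epsilon> unfolding E_def by (intro exI[of _ \<epsilon>]) auto
qed

definition bump :: "'a::euclidean_space \<Rightarrow> real" where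
  "bump x = flat (1 - (norm x)\<^sup>2)"

text \<open>
  The inner \<open>flat\<close> vanishes for \<open>|x| \<le> 1\<close>, which makes the function constant there. It reaches \<open>exp (-1) = flat 1\<close> at
  \<open>|x|\<^sup>2 = 2\<close>, from where on the outer \<open>flat\<close> vanishes. No quotient is involved, so smoothness follows from the chain rule.
\<close>

definition plateau :: "'a::euclidean_space \<Rightarrow> real" where
  "plateau x = flat (exp (- 1) - flat ((norm x)\<^sup>2 - 1))"

lemma Ck_diff: "Ck k f \<Longrightarrow> Ck k g \<Longrightarrow> Ck k (\<lambda>x. f x - g x)"
  using Ck_add[of k f "\<lambda>x. - 1 * g x"] Ck_mult[OF Ck_const[of k "- 1"], of g] by simp

lemma Ck_bump: "Ck k bump"
  unfolding bump_def[abs_def] by (intro Ck_flat Ck_diff Ck_const Ck_norm_square)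

lemma Ck_plateau: "Ck k plateau"
  unfolding plateau_def[abs_def] by (intro Ck_flat Ck_diff Ck_const Ck_norm_square)

lemma bump_properties:
  fixes x :: "'a::euclidean_space"
  shows "radially_decreasing (bump :: 'a \<Rightarrow> real)" "supported_within 1 (bump :: 'a \<Rightarrow> real)"
    "(bump :: 'a \<Rightarrow> real) 0 > 0" "0 \<le> bump x"
proof -
  show "radially_decreasing (bump :: 'a \<Rightarrow> real)"
    unfolding radially_decreasing_def bump_def by (auto intro!: flat_mono power_mono)
  show "supported_within 1 (bump :: 'a \<Rightarrow> real)"
    unfolding supported_within_def bump_def by (auto intro!: flat_nonpos)
qed (simp_all add: bump_def flat_pos_iff flat_nonneg)

lemma plateau_properties:
  fixes x :: "'a::euclidean_space"
  shows "radially_decreasing (plateau :: 'a \<Rightarrow> real)" "supported_within 2 (plateau :: 'a \<Rightarrow> real)"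
    "(plateau :: 'a \<Rightarrow> real) 0 > 0" "norm x \<le> 1 \<Longrightarrow> plateau x = plateau 0"
proof -
  show "radially_decreasing (plateau :: 'a \<Rightarrow> real)"
    unfolding radially_decreasing_def plateau_def by (auto intro!: flat_mono power_mono)
  have one: "flat 1 = exp (- 1)" by (simp add: flat_def)
  show "supported_within 2 (plateau :: 'a \<Rightarrow> real)"
    unfolding supported_within_def plateau_def
  proof (intro allI impI flat_nonpos)
    fix x :: 'a assume "2 < norm x"
    then have "2\<^sup>2 \<le> (norm x)\<^sup>2" by (intro power_mono) auto
    then have "flat 1 \<le> flat ((norm x)\<^sup>2 - 1)" by (intro flat_mono) simp
    then show "exp (- 1) - flat ((norm x)\<^sup>2 - 1) \<le> 0" by (simp add: one)
  qed
  show "plateau x = plateau 0" if "norm x \<le> 1"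
    using that by (simp add: plateau_def flat_nonpos power_le_one)
qed (simp add: plateau_def flat_nonpos flat_pos_iff)

theorem theorem1p2:
  fixes c s p :: real
  assumes "c > 0" and "0 < s" "s < 1" and "1 < p" "p < 2"
  shows "\<exists>u :: 'a::euclidean_space \<Rightarrow> real.
           (\<forall>x. 0 \<le> u x) \<and>
           smooth_compact_support u \<and>
           smooth_compact_support (sym_decr_rearrangement u) \<and>
           Lp_norm p (riesz_gradient c s (sym_decr_rearrangement u))
             > Lp_norm p (riesz_gradient c s u)"
proof -
  note s = assms(2,3) and p = assms(4,5)
  have q: "0 < p - 1" "p - 1 < 1" using p by auto
  let ?f = "plateau :: 'a \<Rightarrow> real" and ?g = "bump :: 'a \<Rightarrow> real"
  note f = plateau_properties[where 'a='a] and g = bump_properties[where 'a='a]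
  obtain a :: 'a where "a \<in> Basis" using nonempty_Basis by blast
  then have a: "norm a = 1" "a \<noteq> 0" by auto
  obtain Mg where gl: "bdd_lipschitz Mg ?g" by (rule bdd_lipschitz_of_Ck1[OF Ck_bump g(2)])
  let ?G = "frac_grad s ?g"
  let ?J = "\<lambda>n. \<integral>x. second_diff (\<lambda>x. duality_map (p - 1) (frac_grad s (rescale s (real (Suc n)) ?f) x)) a x \<bullet> ?G x \<partial>lborel"
  obtain \<kappa> where \<kappa>: "\<kappa> > 0" "?J \<longlonglongrightarrow> - (\<kappa> * (\<integral>x. second_diff (duality_map (p - 1)) a x \<bullet> ?G x \<partial>lborel))"
    by (rule second_diff_pairing_tendsto[OF q s Ck_plateau f(2,1,3) gl g(2)]) blast
  have "- (\<kappa> * (\<integral>x. second_diff (duality_map (p - 1)) a x \<bullet> ?G x \<partial>lborel)) < 0"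
    using \<kappa>(1) second_diff_pairing_pos[OF q s gl g(2,1,4,3) a(2)] by simp
  then have "eventually (\<lambda>n. ?J n < 0) sequentially" by (rule order_tendstoD(2)[OF \<kappa>(2)])
  \<comment> \<open>The radius must be at least \<open>2\<close> so that the bump, of radius \<open>1\<close> and shifted by a unit vector, stays on the plateau.\<close>
  then have "eventually (\<lambda>n. ?J n < 0 \<and> n \<ge> 1) sequentially"
    using eventually_ge_at_top[of 1] by (rule eventually_conj)
  then obtain n where n: "?J n < 0" "n \<ge> 1" using eventually_happens trivial_limit_sequentially by blast
  define R where "R = real (Suc n)"
  have R: "R \<ge> 2" using n(2) by (simp add: R_def)
  define fR where "fR = rescale s R ?f"
  have fR_eq: "fR = (\<lambda>x. R powr (1 + s) * ?f ((1 / R) *\<^sub>R x + 0))" by (simp add: fR_def rescale_def[abs_def])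
  have fR_Ck: "Ck k fR" for k unfolding fR_eq by (intro Ck_mult Ck_const Ck_affine Ck_plateau)
  have fR_supp: "supported_within (2 * R) fR"
    using R by (auto simp: fR_eq supported_within_def field_simps intro!: supported_withinD[OF f(2)])
  have fR_dec: "radially_decreasing fR"
    unfolding radially_decreasing_def fR_eq using R
    by (auto intro!: mult_left_mono radially_decreasingD[OF f(1)] divide_right_mono)
  have fR_plateau: "fR x = fR 0" if "norm x \<le> R" for x
    using R that f(4)[of "(1 / R) *\<^sub>R x"] by (simp add: fR_eq)
  have fR_nn: "0 \<le> fR x" for x by (simp add: fR_eq plateau_def flat_nonneg)
  obtain Mf where fRl: "bdd_lipschitz Mf fR" by (rule bdd_lipschitz_of_Ck1[OF fR_Ck fR_supp])
  let ?F = "frac_grad s fR"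
  have F_meas: "?F \<in> borel_measurable borel" by (rule frac_grad_measurable[OF bdd_lipschitz_measurable[OF fRl]])
  have G_meas: "?G \<in> borel_measurable borel" by (rule frac_grad_measurable[OF bdd_lipschitz_measurable[OF gl]])
  have p1: "1 \<le> p" using p by simp
  obtain \<epsilon> b where \<epsilon>: "\<epsilon> > 0" and b: "b \<in> {a, - a}" and
    less: "(\<integral>x. norm (?F x + \<epsilon> *\<^sub>R ?G (x - b)) powr p \<partial>lborel) < (\<integral>x. norm (?F x + \<epsilon> *\<^sub>R ?G x) powr p \<partial>lborel)"
    using translate_lowers_energy[OF p F_meas G_meas frac_grad_integrable_powr(1)[OF s fRl fR_supp p1]
        frac_grad_integrable_powr(1)[OF s gl g(2) p1] frac_grad_bounded[OF s fRl]
        frac_grad_integrable_powr(2)[OF s gl g(2) p1] n(1)[folded R_def, folded fR_def]] by blast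
  have nb: "norm b = 1" using b a by auto
  define w where "w t = (\<lambda>x. fR x + \<epsilon> * ?g (x - t))" for t
  have bump_t_Ck: "Ck k (\<lambda>x. ?g (x - t))" for k t
    using Ck_affine[OF Ck_bump, of k 1 "- t"] by simp
  have bump_t_supp: "supported_within 2 (\<lambda>x. ?g (x - t))" if "norm t \<le> 1" for t
  proof (unfold supported_within_def, intro allI impI)
    fix x :: 'a assume "2 < norm x"
    then have "1 < norm (x - t)" using norm_triangle_ineq2[of x t] that by linarith
    then show "?g (x - t) = 0" by (rule supported_withinD[OF g(2)])
  qed
  have w_Ck: "Ck k (w t)" for k t
    unfolding w_def by (intro Ck_add Ck_mult Ck_const fR_Ck bump_t_Ck)
  have w_supp: "supported_within (2 * R) (w t)" if "norm t \<le> 1" for t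
    using fR_supp bump_t_supp[OF that] R by (auto simp: supported_within_def w_def)
  have w_grad: "riesz_gradient c s (w t) x = c *\<^sub>R (?F x + \<epsilon> *\<^sub>R ?G (x - t))" if t: "norm t \<le> 1" for t x
  proof -
    obtain M where M: "bdd_lipschitz M (\<lambda>x. ?g (x - t))"
      by (rule bdd_lipschitz_of_Ck1[OF bump_t_Ck bump_t_supp[OF t]])
    obtain M' where M': "bdd_lipschitz M' (w t)" by (rule bdd_lipschitz_of_Ck1[OF w_Ck w_supp[OF t]])
    have "frac_grad s (w t) x = frac_grad s (\<lambda>x. 1 * fR x + \<epsilon> * ?g (x - t)) x" by (simp add: w_def)
    also have "\<dots> = ?F x + \<epsilon> *\<^sub>R ?G (x - t)"
      by (simp only: frac_grad_linear[OF s fRl M] frac_grad_translate scaleR_one)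
    finally show ?thesis by (simp add: riesz_gradient_eq[OF bdd_lipschitz_measurable[OF M']])
  qed
  have w_norm: "Lp_norm p (riesz_gradient c s (w t))
      = ennreal ((c powr p * (\<integral>x. norm (?F x + \<epsilon> *\<^sub>R ?G (x - t)) powr p \<partial>lborel)) powr (1 / p))"
    if t: "norm t \<le> 1" for t
  proof -
    obtain M' where M': "bdd_lipschitz M' (w t)" by (rule bdd_lipschitz_of_Ck1[OF w_Ck w_supp[OF t]])
    have eq: "norm (riesz_gradient c s (w t) x) powr p = c powr p * norm (frac_grad s (w t) x) powr p" for x
      using assms(1) by (simp add: riesz_gradient_eq[OF bdd_lipschitz_measurable[OF M']] powr_mult)
    have "integrable lborel (\<lambda>x. norm (riesz_gradient c s (w t) x) powr p)"
      unfolding eq by (intro integrable_mult_right frac_grad_integrable_powr(1)[OF s M' w_supp[OF t] p1])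
    then have "Lp_norm p (riesz_gradient c s (w t))
        = ennreal ((\<integral>x. norm (riesz_gradient c s (w t) x) powr p \<partial>lborel) powr (1 / p))"
      by (rule Lp_norm_eq)
    also have "(\<integral>x. norm (riesz_gradient c s (w t) x) powr p \<partial>lborel)
        = c powr p * (\<integral>x. norm (?F x + \<epsilon> *\<^sub>R ?G (x - t)) powr p \<partial>lborel)"
      unfolding w_grad[OF t] using assms(1) by (simp add: powr_mult)
    finally show ?thesis .
  qed
  have w_dec: "radially_decreasing (w 0)"
    using \<epsilon> by (auto simp: radially_decreasing_def w_def
        intro!: add_mono mult_left_mono radially_decreasingD[OF fR_dec] radially_decreasingD[OF g(1)])
  have w_nn: "0 \<le> w t x" for t x
    using \<epsilon> fR_nn[of x] g(4)[of "x - t"] by (simp add: w_def)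
  have w_cont: "continuous_on UNIV (w t)" for t using w_Ck[of 0 t] by simp
  have star: "sym_decr_rearrangement (w b) = w 0"
  proof (rule sym_decr_rearrangement_eqI[OF w_dec w_cont w_supp w_nn])
    fix l :: real
    have gc: "continuous_on UNIV (\<lambda>x. \<epsilon> * ?g x)" using Ck_bump[of 0] by (intro continuous_intros) simp
    have "emeasure lebesgue {y. fR y + \<epsilon> * ?g (y - b) > l} = emeasure lebesgue {y. fR y + \<epsilon> * ?g y > l}"
    proof (rule emeasure_superlevel_translate_bump[where P=R and Q=1])
      show "fR x \<le> fR 0" for x by (rule radially_decreasingD[OF fR_dec]) simp
      show "supported_within 1 (\<lambda>x. \<epsilon> * ?g x)" using g(2) by (simp add: supported_within_def)
      show "0 \<le> \<epsilon> * ?g x" for x using \<epsilon> g(4)[of x] by simp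
      show "fR x = fR 0" if "norm x \<le> R" for x by (rule fR_plateau[OF that])
      show "1 + norm b \<le> R" using nb R by simp
    qed (rule gc)
    then show "emeasure lebesgue {y. w b y > l} = emeasure lebesgue {y. w 0 y > l}" by (simp add: w_def)
  qed simp
  have "Lp_norm p (riesz_gradient c s (w b)) < Lp_norm p (riesz_gradient c s (w 0))"
  proof -
    have "c powr p * (\<integral>x. norm (?F x + \<epsilon> *\<^sub>R ?G (x - b)) powr p \<partial>lborel)
        < c powr p * (\<integral>x. norm (?F x + \<epsilon> *\<^sub>R ?G x) powr p \<partial>lborel)"
      using less assms(1) by simp
    then have "(c powr p * (\<integral>x. norm (?F x + \<epsilon> *\<^sub>R ?G (x - b)) powr p \<partial>lborel)) powr (1 / p)
        < (c powr p * (\<integral>x. norm (?F x + \<epsilon> *\<^sub>R ?G x) powr p \<partial>lborel)) powr (1 / p)"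
      using p by (intro powr_less_mono2) auto
    then show ?thesis using w_norm[of b] w_norm[of 0] nb by (simp add: ennreal_less_iff)
  qed
  moreover have "smooth_compact_support (w b)" "smooth_compact_support (w 0)"
    using nb by (auto intro!: smooth_compact_supportI[OF w_Ck w_supp])
  ultimately show ?thesis
    using w_nn[of b] by (intro exI[of _ "w b"]) (simp add: star)
qed

end
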